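(* Let $\mathcal H$ be a complex separable Hilbert space, let $\varepsilon>0$, and let $S$ be a densely defined, closed operator in $\mathcal H$ with $S\geq \varepsilon I_{\mathcal H}$ and deficiency indices $(r,r)$, $r\in\mathbb N\cup\{\infty\}$. Let $S_F$ be the Friedrichs extension of $S$, $S_K$ the Krein--von Neumann extension of $S$, $P_{\ker(S_K)}$ the orthogonal projection in $\mathcal H$ onto $\ker(S_K)=\ker(S^* )$, $\widehat{\mathcal H}=[\ker(S_K)]^{\perp}=[I_{\mathcal H}-P_{\ker(S_K)}]\mathcal H$, and $\widehat S_K=S_K|_{[\ker(S_K)]^\perp}$ the reduced Krein--von Neumann operator in $\widehat{\mathcal H}$. Let $p\in(0,\infty]$. Then the following items (i)--(iv) are equivalent: (i) $(\widehat S_K)^{-1}\in\mathcal B_p(\widehat{\mathcal H})$. (ii) $[I_{\mathcal H}-P_{\ker(S_K)}](S_F)^{-1}[I_{\mathcal H}-P_{\ker(S_K)}]\in\mathcal B_p(\mathcal H)$. (iii) $[I_{\mathcal H}-P_{\ker(S_K)}](S_F)^{-1/2}\in\mathcal B_{2p}(\mathcal H)$. (iv) $(S_F)^{-1/2}[I_{\mathcal H}-P_{\ker(S_K)}]\in\mathcal B_{2p}(\mathcal H)$. In particular, $(S_F)^{-1}\in\mathcal B_p(\mathcal H)$ implies $(\widehat S_K)^{-1}\in\mathcal B_p(\widehat{\mathcal H})$.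
   Context: $S\geq\varepsilon I_{\mathcal H}$ means $(u,Su)_{\mathcal H}\geq\varepsilon\|u\|^2_{\mathcal H}$ for all $u\in\mathrm{dom}(S)$ (in particular $S$ is symmetric). The deficiency indices are $\dim\ker(S^*\mp iI_{\mathcal H})$; both equal $r\geq 1$. The Friedrichs extension $S_F$ and Krein--von Neumann extension $S_K$ of $S$ are, respectively, the largest and the smallest nonnegative self-adjoint extensions of $S$: every nonnegative self-adjoint extension $\widetilde S$ of $S$ satisfies $(S_F+aI_{\mathcal H})^{-1}\leq(\widetilde S+aI_{\mathcal H})^{-1}\leq(S_K+aI_{\mathcal H})^{-1}$ for all $a>0$. Equivalently, $S_F$ is the self-adjoint operator associated with the closure of the form $q_S(f,g)=(f,Sg)_{\mathcal H}$, $f,g\in\mathrm{dom}(S)$, and satisfies $S_F\geq\varepsilon I_{\mathcal H}$; and, since $S\ge\varepsilon I_{\mathcal H}$, $S_K$ is the restriction of $S^*$ to $\mathrm{dom}(S_K)=\mathrm{dom}(S)\dotplus\ker(S^* )$ (direct, not necessarily orthogonal, sum), so that $\ker(S_K)=\ker(S^* )=\mathrm{ran}(S)^\perp$. The reduced operator $\widehat S_K$ is the self-adjoint operator in $\widehat{\mathcal H}$ given by restricting $S_K$ to $\mathrm{dom}(S_K)\cap\widehat{\mathcal H}$; it is boundedly invertible in $\widehat{\mathcal H}$. $\mathcal B_p(\mathcal H)$, $p\in(0,\infty)$, denotes the $\ell^p$-based Schatten--von Neumann class (compact operators whose singular values are in $\ell^p$), and $\mathcal B_\infty(\mathcal H)$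 denotes the compact operators on $\mathcal H$; for $p=\infty$ one sets $2p=\infty$. *)

theory Defs
  imports "HOL-Analysis.Analysis" "HOL-Library.Extended_Nat" "HOL-Library.Extended_Real"
begin

section \<open>Complex Hilbert spaces\<close>

text \<open>The complex inner product is conjugate-linear in the first and linear in the second
  argument.  Its real part is the inner product of the underlying real inner product space, so
  that the norm and the topology come from \<open>real_inner\<close>.\<close>

class complex_inner = real_inner +
  fixes scaleC :: "complex \<Rightarrow> 'a \<Rightarrow> 'a" (infixr "*\<^sub>C" 75)
    and cinner :: "'a \<Rightarrow> 'a \<Rightarrow> complex"
  assumes scaleC_add_right: "c *\<^sub>C (x + y) = c *\<^sub>C x + c *\<^sub>C y"
    and scaleC_add_left: "(c + d) *\<^sub>C x = c *\<^sub>C x + d *\<^sub>C x"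
    and scaleC_scaleC: "c *\<^sub>C d *\<^sub>C x = (c * d) *\<^sub>C x"
    and scaleC_of_real: "complex_of_real r *\<^sub>C x = r *\<^sub>R x"
    and cinner_commute: "cinner x y = cnj (cinner y x)"
    and cinner_add_right: "cinner x (y + z) = cinner x y + cinner x z"
    and cinner_scaleC_right: "cinner x (c *\<^sub>C y) = c * cinner x y"
    and Re_cinner: "Re (cinner x y) = inner x y"

class complex_hilbert = complex_inner + complete_space

interpretation complex_vector: vector_space "scaleC :: complex \<Rightarrow> 'a \<Rightarrow> 'a::complex_inner"
proof
  fix x :: 'a
  show "1 *\<^sub>C x = x"
    using scaleC_of_real[of 1 x] by simp
qed (simp_all add: scaleC_add_right scaleC_add_left scaleC_scaleC)

definition complex_dimension :: "'a::complex_inner set \<Rightarrow> enat" where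
  "complex_dimension V =
    (if \<exists>B. finite B \<and> V \<subseteq> complex_vector.span B then enat (complex_vector.dim V) else \<infinity>)"

definition orth_compl :: "'a::complex_inner set \<Rightarrow> 'a set" where
  "orth_compl M = {x. \<forall>y\<in>M. cinner y x = 0}"


section \<open>Unbounded operators\<close>

text \<open>A (possibly unbounded) operator is identified with its graph.  Thus its domain is
  \<^const>\<open>Domain\<close>, an extension is a superset, the identity is \<^const>\<open>Id\<close>, and the inverse of an
  injective operator is the converse relation.  The argument \<open>M\<close> below is the Hilbert space in
  which the operator acts: a closed complex subspace of the ambient type, with
  \<open>M = UNIV\<close> for the ambient space itself.\<close>

type_synonym 'a operator = "('a \<times> 'a) set"

definition linear_operator :: "'a::complex_inner set \<Rightarrow> 'a operator \<Rightarrow> bool" where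
  "linear_operator M T \<longleftrightarrow>
     T \<subseteq> M \<times> M \<and> single_valued T \<and> (0, 0) \<in> T \<and>
     (\<forall>x y x' y'. (x, y) \<in> T \<longrightarrow> (x', y') \<in> T \<longrightarrow> (x + x', y + y') \<in> T) \<and>
     (\<forall>c x y. (x, y) \<in> T \<longrightarrow> (c *\<^sub>C x, c *\<^sub>C y) \<in> T)"

definition op_comp :: "'a operator \<Rightarrow> 'a operator \<Rightarrow> 'a operator" (infixr "\<circ>\<^sub>o" 70) where
  "A \<circ>\<^sub>o B = B O A"

definition op_diff :: "'a::complex_inner operator \<Rightarrow> 'a operator \<Rightarrow> 'a operator"
    (infixl "-\<^sub>o" 65) where
  "A -\<^sub>o B = {(x, y - z) | x y z. (x, y) \<in> A \<and> (x, z) \<in> B}"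

text \<open>\<open>op_shift T c\<close> is \<open>T + c I\<close>, with the same domain as \<open>T\<close>.\<close>

definition op_shift :: "'a::complex_inner operator \<Rightarrow> complex \<Rightarrow> 'a operator" where
  "op_shift T c = {(x, y + c *\<^sub>C x) | x y. (x, y) \<in> T}"

definition op_ker :: "'a::complex_inner operator \<Rightarrow> 'a set" where
  "op_ker T = {x. (x, 0) \<in> T}"

definition op_adjoint :: "'a::complex_inner set \<Rightarrow> 'a operator \<Rightarrow> 'a operator" where
  "op_adjoint M T =
     {(f, g). f \<in> M \<and> g \<in> M \<and> (\<forall>(u, v)\<in>T. cinner f v = cinner g u)}"

definition densely_defined :: "'a::complex_inner operator \<Rightarrow> bool" where
  "densely_defined T \<longleftrightarrow> closure (Domain T) = UNIV"

definition self_adjoint :: "'a::complex_inner operator \<Rightarrow> bool" where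
  "self_adjoint T \<longleftrightarrow>
     linear_operator UNIV T \<and> densely_defined T \<and> op_adjoint UNIV T = T"

text \<open>\<open>bounded_below_by \<epsilon> S\<close> is \<open>S \<ge> \<epsilon> I\<close>; the reality of the quadratic form makes \<open>S\<close>
  symmetric.\<close>

definition bounded_below_by :: "real \<Rightarrow> 'a::complex_inner operator \<Rightarrow> bool" where
  "bounded_below_by \<epsilon> S \<longleftrightarrow>
     (\<forall>(u, v)\<in>S. cinner u v \<in> \<real> \<and> \<epsilon> * (norm u)\<^sup>2 \<le> Re (cinner u v))"

text \<open>Used for bounded self-adjoint \<open>A\<close> and \<open>B\<close> defined on the whole space, where the two inner
  products are real.\<close>

definition op_le :: "'a::complex_inner operator \<Rightarrow> 'a operator \<Rightarrow> bool" where
  "op_le A B \<longleftrightarrow>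
     (\<forall>x y z. (x, y) \<in> A \<longrightarrow> (x, z) \<in> B \<longrightarrow> Re (cinner x y) \<le> Re (cinner x z))"

definition orth_proj :: "'a::complex_inner set \<Rightarrow> 'a operator" where
  "orth_proj M = {(x, y). y \<in> M \<and> x - y \<in> orth_compl M}"

text \<open>The unique nonnegative self-adjoint square root.\<close>

definition op_sqrt :: "'a::complex_inner operator \<Rightarrow> 'a operator" where
  "op_sqrt A = (THE R. self_adjoint R \<and> bounded_below_by 0 R \<and> R \<circ>\<^sub>o R = A)"


section \<open>Friedrichs and Krein-von Neumann extensions\<close>

definition nonneg_sa_extension :: "'a::complex_inner operator \<Rightarrow> 'a operator \<Rightarrow> bool" where
  "nonneg_sa_extension S T \<longleftrightarrow> S \<subseteq> T \<and> self_adjoint T \<and> bounded_below_by 0 T"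

text \<open>The order on nonnegative self-adjoint operators is expressed by the resolvents, which
  reverse it: the Friedrichs extension is the largest nonnegative self-adjoint extension, the
  Krein-von Neumann extension the smallest.\<close>

definition friedrichs_extension :: "'a::complex_inner operator \<Rightarrow> 'a operator \<Rightarrow> bool" where
  "friedrichs_extension S T \<longleftrightarrow>
     nonneg_sa_extension S T \<and>
     (\<forall>T'. nonneg_sa_extension S T' \<longrightarrow>
        (\<forall>a::real. a > 0 \<longrightarrow>
           op_le ((op_shift T (of_real a))\<inverse>) ((op_shift T' (of_real a))\<inverse>)))"

definition krein_von_neumann_extension ::
    "'a::complex_inner operator \<Rightarrow> 'a operator \<Rightarrow> bool" where
  "krein_von_neumann_extension S T \<longleftrightarrow>
     nonneg_sa_extension S T \<and>
     (\<forall>T'. nonneg_sa_extension S T' \<longrightarrow>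
        (\<forall>a::real. a > 0 \<longrightarrow>
           op_le ((op_shift T' (of_real a))\<inverse>) ((op_shift T (of_real a))\<inverse>)))"

text \<open>The part of \<open>T\<close> in the orthogonal complement of its kernel.\<close>

definition reduced_operator :: "'a::complex_inner operator \<Rightarrow> 'a operator" where
  "reduced_operator T = {(x, y) \<in> T. x \<in> orth_compl (op_ker T)}"


section \<open>Schatten-von Neumann classes\<close>

definition compact_operator :: "'a::complex_inner set \<Rightarrow> 'a operator \<Rightarrow> bool" where
  "compact_operator M T \<longleftrightarrow>
     linear_operator M T \<and> Domain T = M \<and> compact (closure (T `` (M \<inter> cball 0 1)))"

text \<open>\<open>s\<close> lists the singular values of \<open>T\<close> in decreasing order: every \<open>\<sigma> > 0\<close> occurs in it as
  often as the multiplicity of \<open>\<sigma>\<^sup>2\<close> as an eigenvalue of \<open>T\<^sup>* T\<close>.  If there are only finitely many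
  nonzero singular values, the sequence is continued by zeros.\<close>

definition singular_values ::
    "'a::complex_inner set \<Rightarrow> 'a operator \<Rightarrow> (nat \<Rightarrow> real) \<Rightarrow> bool" where
  "singular_values M T s \<longleftrightarrow>
     decseq s \<and> (\<forall>n. 0 \<le> s n) \<and>
     (\<forall>\<sigma>>0. finite {n. s n = \<sigma>} \<and>
        complex_dimension (op_ker (op_shift (op_adjoint M T \<circ>\<^sub>o T) (- of_real (\<sigma>\<^sup>2))))
          = enat (card {n. s n = \<sigma>}))"

text \<open>For \<open>p = \<infinity>\<close> these are the compact operators; \<open>0 powr p = 0\<close> makes the zero entries of
  the sequence harmless.\<close>

definition schatten_class :: "ereal \<Rightarrow> 'a::complex_inner set \<Rightarrow> 'a operator set" where
  "schatten_class p M =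
     {T. compact_operator M T \<and>
         (p \<noteq> \<infinity> \<longrightarrow>
            (\<exists>s. singular_values M T s \<and> summable (\<lambda>n. s n powr real_of_ereal p)))}"

end

theory Submission
  imports Defs
begin

text \<open>
  Write \<open>P\<close> for the orthogonal projection onto \<open>ker(S\<^sub>K)\<^sup>\<bottom>\<close> and \<open>A = S\<^sub>F\<^sup>-\<^sup>1\<close>. Everything follows from the
  identity \<open>(reduced S\<^sub>K)\<^sup>-\<^sup>1 = P A\<close> on the range of \<open>P\<close>. Since \<open>S\<close> is closed and strictly positive, its
  range is closed; it equals \<open>ker(S\<^sub>K)\<^sup>\<bottom>\<close>. So each \<open>y\<close> in the range of \<open>P\<close> is \<open>S u\<close> for some \<open>u\<close>. Then
  \<open>A y = u\<close> because \<open>S\<^sub>F\<close> extends \<open>S\<close>, while \<open>S\<^sub>K (P u) = S\<^sub>K u = y\<close> because \<open>u - P u\<close> is in the kernel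
  of \<open>S\<^sub>K\<close> (\<open>reduced_operator_inverse\<close>).

  Two facts about the extremal extensions enter: \<open>S\<^sub>F\<close> is strictly positive, so that \<open>A\<close> is bounded
  (\<open>friedrichs_extension_bounded_below\<close>), and \<open>ker(S\<^sub>K) = ran(S)\<^sup>\<bottom>\<close> (\<open>krein_von_neumann_kernel\<close>). Both
  are derived from extremality by comparison with explicit extensions. The operator that acts as \<open>S\<close> on
  \<open>dom(S)\<close> and as zero on \<open>ran(S)\<^sup>\<bottom>\<close> is self-adjoint and nonnegative, which settles the kernel of the
  smallest extension. The same construction for \<open>S - \<epsilon>/2\<close>, shifted back, is a strictly positive extension
  of \<open>S\<close>, which settles the lower bound of the largest one; no completion in the form norm is involved.

  Now let \<open>C\<close> be the square root of \<open>A\<close> and \<open>T = C P\<close>, so that \<open>T\<^sup>* = P C\<close> and \<open>T\<^sup>*T = P A P\<close>. The four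
  operators of the theorem are \<open>P A\<close> on the range of \<open>P\<close>, \<open>T\<^sup>*T\<close>, \<open>T\<^sup>*\<close> and \<open>T\<close>. The first two have the
  same image of the unit ball and the same positive singular values (\<open>schatten_class_restrict_iff\<close>), the
  singular values of \<open>T\<^sup>*T\<close> are the squares of those of \<open>T\<close> (\<open>schatten_class_gram_iff\<close>), and \<open>T\<close> and
  \<open>T\<^sup>*\<close> have the same singular values (\<open>schatten_class_adjoint_imp\<close>).

  The last assertion says that \<open>A \<in> \<B>\<^sub>p\<close> implies \<open>P A P \<in> \<B>\<^sub>p\<close> (\<open>schatten_class_compression\<close>). It is the
  only part that needs the spectral theorem: first to know that the compact operator \<open>P A P\<close> has a sequence
  of singular values at all, then for the min-max comparison of that sequence with the one of \<open>A\<close>.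
\<close>


section \<open>Geometry of complex Hilbert spaces\<close>

lemma cinner_add_left: "cinner (x + y) z = cinner x z + cinner y (z::'a::complex_inner)"
  by (metis cinner_add_right cinner_commute complex_cnj_add)

lemma cinner_scaleC_left: "cinner (c *\<^sub>C x) y = cnj c * cinner x (y::'a::complex_inner)"
  by (metis cinner_commute cinner_scaleC_right complex_cnj_cnj complex_cnj_mult)

lemma scaleR_eq_scaleC: "r *\<^sub>R x = complex_of_real r *\<^sub>C (x::'a::complex_inner)"
  by (simp add: scaleC_of_real)

lemma cinner_scaleR_right [simp]: "cinner x (r *\<^sub>R y) = r * cinner x (y::'a::complex_inner)"
  by (simp add: scaleR_eq_scaleC cinner_scaleC_right)

lemma cinner_scaleR_left [simp]: "cinner (r *\<^sub>R x) y = r * cinner x (y::'a::complex_inner)"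
  by (simp add: scaleR_eq_scaleC cinner_scaleC_left)

lemma cinner_zero_right [simp]: "cinner x 0 = (0::complex)" for x :: "'a::complex_inner"
  using cinner_scaleR_right[of x 0 0] by simp

lemma cinner_zero_left [simp]: "cinner 0 x = (0::complex)" for x :: "'a::complex_inner"
  using cinner_scaleR_left[of 0 0 x] by simp

lemma cinner_minus_right [simp]: "cinner x (- y) = - cinner x (y::'a::complex_inner)"
  using cinner_scaleR_right[of x "-1" y] by simp

lemma cinner_minus_left [simp]: "cinner (- x) y = - cinner x (y::'a::complex_inner)"
  using cinner_scaleR_left[of "-1" x y] by simp

lemma cinner_diff_right: "cinner x (y - z) = cinner x y - cinner x (z::'a::complex_inner)"
  using cinner_add_right[of x y "-z"] by simp

lemma cinner_diff_left: "cinner (x - y) z = cinner x z - cinner y (z::'a::complex_inner)"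
  using cinner_add_left[of x "-y" z] by simp

lemmas cinner_algebra = cinner_add_left cinner_add_right cinner_diff_left cinner_diff_right
  cinner_scaleC_left cinner_scaleC_right

lemma Im_cinner: "Im (cinner x y) = inner (\<i> *\<^sub>C x) (y::'a::complex_inner)"
  by (simp add: Re_cinner[symmetric] cinner_scaleC_left)

lemma cinner_eq_Complex:
  "cinner x y = Complex (inner x y) (inner (\<i> *\<^sub>C x) (y::'a::complex_inner))"
  by (simp add: complex_eq_iff Re_cinner Im_cinner)

lemma cinner_self: "cinner x x = complex_of_real ((norm x)\<^sup>2)" for x :: "'a::complex_inner"
proof -
  have "cinner x x = cnj (cinner x x)" by (rule cinner_commute)
  hence "Im (cinner x x) = 0" by (metis Reals_cnj_iff complex_is_Real_iff)
  thus ?thesis by (simp add: complex_eq_iff Re_cinner dot_square_norm)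
qed

lemma cinner_self_eq_0 [simp]: "cinner x x = 0 \<longleftrightarrow> x = (0::'a::complex_inner)"
  by (simp add: cinner_self)

lemma norm_scaleC: "norm (c *\<^sub>C x) = cmod c * norm (x::'a::complex_inner)"
proof -
  have "complex_of_real ((norm (c *\<^sub>C x))\<^sup>2) = of_real ((cmod c * norm x)\<^sup>2)"
  proof -
    have "complex_of_real ((norm (c *\<^sub>C x))\<^sup>2) = (c * cnj c) * cinner x x"
      unfolding cinner_self[symmetric] by (simp add: cinner_algebra mult_ac)
    also have "\<dots> = of_real ((cmod c)\<^sup>2) * of_real ((norm x)\<^sup>2)"
      by (simp only: complex_norm_square cinner_self)
    finally show ?thesis by (simp add: power_mult_distrib)
  qed
  hence "(norm (c *\<^sub>C x))\<^sup>2 = (cmod c * norm x)\<^sup>2" using of_real_eq_iff by blast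
  thus ?thesis by simp
qed

lemma cinner_ext_left:
  assumes "\<And>u. cinner a u = cinner b (u::'a::complex_inner)" shows "a = b"
proof -
  have "cinner (a - b) (a - b) = 0" using assms by (simp add: cinner_algebra)
  thus ?thesis by simp
qed

lemma bounded_linear_scaleC: "bounded_linear (\<lambda>x::'a::complex_inner. c *\<^sub>C x)"
  by (rule bounded_linear_intro[where K="cmod c"])
     (simp_all add: scaleC_add_right norm_scaleC scaleR_eq_scaleC scaleC_scaleC mult.commute)

lemma tendsto_cinner [tendsto_intros]:
  assumes "(f \<longlongrightarrow> a) F" "(g \<longlongrightarrow> b) F"
  shows "((\<lambda>x. cinner (f x) (g x)) \<longlongrightarrow> cinner a (b::'a::complex_inner)) F"
  unfolding cinner_eq_Complex
  by (intro tendsto_Complex tendsto_inner assms bounded_linear.tendsto[OF bounded_linear_scaleC])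

lemma continuous_on_cinner [continuous_intros]:
  assumes "continuous_on S f" "continuous_on S g"
  shows "continuous_on S (\<lambda>x. cinner (f x) (g x :: 'a::complex_inner))"
  using assms unfolding continuous_on_def by (auto intro: tendsto_cinner)

lemma subspace_scaleR:
  "complex_vector.subspace M \<Longrightarrow> x \<in> M \<Longrightarrow> r *\<^sub>R x \<in> (M::'a::complex_inner set)"
  by (simp add: scaleR_eq_scaleC complex_vector.subspace_scale)

lemma subspace_orth_compl: "complex_vector.subspace (orth_compl M :: 'a::complex_inner set)"
  by (auto simp: complex_vector.subspace_def orth_compl_def cinner_algebra)

lemma closed_orth_compl: "closed (orth_compl M :: 'a::complex_inner set)"
proof -
  have "orth_compl M = (\<Inter>y\<in>M. {x. cinner y x = 0})" by (auto simp: orth_compl_def)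
  moreover have "closed {x. cinner y x = 0}" for y :: 'a
    by (intro closed_Collect_eq continuous_intros)
  ultimately show ?thesis by auto
qed

lemma orth_compl_commute: "x \<in> orth_compl M \<Longrightarrow> y \<in> M \<Longrightarrow> cinner x y = 0"
  unfolding orth_compl_def by (metis (mono_tags) cinner_commute complex_cnj_zero mem_Collect_eq)

lemma orth_compl_Int: "x \<in> M \<Longrightarrow> x \<in> orth_compl M \<Longrightarrow> x = 0"
  unfolding orth_compl_def by auto

text \<open>If \<open>x - y\<close> were not orthogonal to some \<open>m \<in> M\<close>, moving \<open>y\<close> along \<open>m\<close> would bring it closer to \<open>x\<close>.
  For the real inner product this is the minimum of a quadratic polynomial; replacing \<open>m\<close> by \<open>\<i> m\<close> then
  gives the complex statement.\<close>

lemma minimal_distance_orthogonal: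
  fixes x :: "'a::complex_inner"
  assumes M: "complex_vector.subspace M" and y: "y \<in> M"
    and min: "\<And>z. z \<in> M \<Longrightarrow> norm (x - y) \<le> norm (x - z)"
  shows "x - y \<in> orth_compl M"
proof -
  have re: "inner m (x - y) = 0" if m: "m \<in> M" for m
  proof (cases "m = 0")
    case False
    define t where "t = inner m (x - y) / (norm m)\<^sup>2"
    have "norm (x - y) \<le> norm (x - (y + t *\<^sub>R m))"
      by (intro min complex_vector.subspace_add[OF M y] subspace_scaleR[OF M m])
    hence "(norm (x - y))\<^sup>2 \<le> (norm ((x - y) - t *\<^sub>R m))\<^sup>2"
      by (simp add: power_mono diff_diff_eq)
    also have "\<dots> = (norm (x - y))\<^sup>2 - 2 * t * inner m (x - y) + t\<^sup>2 * (norm m)\<^sup>2"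
      unfolding power2_norm_eq_inner
      by (simp add: inner_diff_left inner_diff_right inner_commute power2_eq_square
          inner_add_left inner_add_right algebra_simps)
    also have "\<dots> = (norm (x - y))\<^sup>2 - (inner m (x - y))\<^sup>2 / (norm m)\<^sup>2"
      using False by (simp add: t_def power2_eq_square field_simps)
    finally have "(inner m (x - y))\<^sup>2 / (norm m)\<^sup>2 \<le> 0" by simp
    hence "(inner m (x - y))\<^sup>2 \<le> 0" using False by (simp add: divide_le_0_iff)
    thus ?thesis by simp
  qed simp
  have "cinner m (x - y) = 0" if m: "m \<in> M" for m
    using re[OF m] re[OF complex_vector.subspace_scale[OF M m, of \<i>]]
    by (simp add: cinner_eq_Complex complex_eq_iff)
  thus ?thesis by (simp add: orth_compl_def)
qed

text \<open>By the parallelogram law a minimising sequence is Cauchy, so the distance to a closed subspace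
  is attained.\<close>

lemma orthogonal_decomposition:
  fixes x :: "'a::complex_hilbert"
  assumes M: "complex_vector.subspace M" and "closed M"
  obtains y where "y \<in> M" "x - y \<in> orth_compl M"
proof -
  define d where "d = (INF m\<in>M. norm (x - m))"
  have M0: "0 \<in> M" using M complex_vector.subspace_0 by blast
  have bdd: "bdd_below ((\<lambda>m. norm (x - m)) ` M)" by (rule bdd_belowI[of _ 0]) auto
  have dle: "d \<le> norm (x - m)" if "m \<in> M" for m
    unfolding d_def using bdd that by (rule cINF_lower)
  have d0: "0 \<le> d" unfolding d_def using M0 by (intro cINF_greatest) auto
  have "\<exists>m\<in>M. norm (x - m) < d + 1 / (real n + 1)" for n
  proof (rule ccontr)
    assume "\<not> ?thesis"
    hence "d + 1 / (real n + 1) \<le> d"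
      unfolding d_def using M0 by (intro cINF_greatest) (auto simp: not_less)
    thus False by (simp add: field_simps)
  qed
  then obtain m where mM: "\<And>n. m n \<in> M" and m: "\<And>n. norm (x - m n) < d + 1 / (real n + 1)"
    by metis
  have lim: "(\<lambda>n. norm (x - m n)) \<longlonglongrightarrow> d"
  proof (rule tendsto_sandwich[OF _ _ tendsto_const])
    show "(\<lambda>n. d + 1 / (real n + 1)) \<longlonglongrightarrow> d"
      using tendsto_add[OF tendsto_const LIMSEQ_inverse_real_of_nat, of d]
      by (simp add: inverse_eq_divide add.commute)
  qed (use dle mM m in \<open>auto intro!: always_eventually less_imp_le\<close>)
  have par: "(norm (m i - m j))\<^sup>2 \<le> 2 * (norm (x - m i))\<^sup>2 + 2 * (norm (x - m j))\<^sup>2 - 4 * d\<^sup>2" for i j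
  proof -
    have "d \<le> norm (x - (1/2) *\<^sub>R (m i + m j))"
      by (intro dle subspace_scaleR[OF M] complex_vector.subspace_add[OF M] mM)
    hence "d\<^sup>2 \<le> (norm (x - (1/2) *\<^sub>R (m i + m j)))\<^sup>2" using d0 by (simp add: power_mono)
    moreover have "(norm (m i - m j))\<^sup>2 + 4 * (norm (x - (1/2) *\<^sub>R (m i + m j)))\<^sup>2
        = 2 * (norm (x - m i))\<^sup>2 + 2 * (norm (x - m j))\<^sup>2"
      by (simp add: power2_norm_eq_inner inner_diff_left inner_diff_right inner_add_left
          inner_add_right inner_commute algebra_simps)
    ultimately show ?thesis by simp
  qed
  have "Cauchy m"
  proof (rule metric_CauchyI)
    fix e :: real assume e: "0 < e"
    have "(\<lambda>n. (norm (x - m n))\<^sup>2) \<longlonglongrightarrow> d\<^sup>2" by (intro tendsto_intros lim)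
    hence "\<forall>\<^sub>F n in sequentially. (norm (x - m n))\<^sup>2 < d\<^sup>2 + e\<^sup>2 / 4"
      by (rule order_tendstoD) (use e in simp)
    then obtain N where N: "\<And>n. n \<ge> N \<Longrightarrow> (norm (x - m n))\<^sup>2 < d\<^sup>2 + e\<^sup>2 / 4"
      unfolding eventually_sequentially by blast
    have "dist (m i) (m j) < e" if "i \<ge> N" "j \<ge> N" for i j
    proof -
      have "(norm (m i - m j))\<^sup>2 < e\<^sup>2" using par[of i j] N[OF that(1)] N[OF that(2)] by linarith
      thus ?thesis using e by (simp add: dist_norm power_less_imp_less_base)
    qed
    thus "\<exists>N. \<forall>i\<ge>N. \<forall>j\<ge>N. dist (m i) (m j) < e" by blast
  qed
  then obtain y where y: "m \<longlonglongrightarrow> y" using Cauchy_convergent_iff convergent_def by blast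
  have yM: "y \<in> M" using \<open>closed M\<close> mM y closed_sequentially by blast
  have "(\<lambda>n. norm (x - m n)) \<longlonglongrightarrow> norm (x - y)" by (intro tendsto_intros y)
  hence "norm (x - y) = d" using lim LIMSEQ_unique by blast
  hence "x - y \<in> orth_compl M" using minimal_distance_orthogonal[OF M yM] dle by simp
  thus thesis using that yM by blast
qed

lemma orth_compl_orth_compl:
  fixes M :: "'a::complex_hilbert set"
  assumes M: "complex_vector.subspace M" "closed M"
  shows "orth_compl (orth_compl M) = M"
proof
  show "M \<subseteq> orth_compl (orth_compl M)"
    using orth_compl_commute by (force simp: orth_compl_def[of "orth_compl M"])
  show "orth_compl (orth_compl M) \<subseteq> M"
  proof
    fix x assume x: "x \<in> orth_compl (orth_compl M)"
    obtain y where y: "y \<in> M" "x - y \<in> orth_compl M" using orthogonal_decomposition[OF M] .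
    have "cinner (x - y) x = 0" using x y(2) by (auto simp: orth_compl_def)
    moreover have "cinner (x - y) y = 0" using y orth_compl_commute by blast
    ultimately have "cinner (x - y) (x - y) = 0" by (simp add: cinner_diff_right)
    thus "x \<in> M" using y by simp
  qed
qed


section \<open>Bounded operators as functions\<close>

text \<open>Everywhere defined operators are handled as functions, and \<open>op_of\<close> turns them back into
  graphs.\<close>

definition op_of :: "('a \<Rightarrow> 'a) \<Rightarrow> 'a operator" where
  "op_of f = {(x, y). y = f x}"

definition bounded_op :: "('a::complex_inner \<Rightarrow> 'a) \<Rightarrow> bool" where
  "bounded_op f \<longleftrightarrow> bounded_linear f \<and> (\<forall>c x. f (c *\<^sub>C x) = c *\<^sub>C f x)"

definition adjoint_pair :: "('a::complex_inner \<Rightarrow> 'a) \<Rightarrow> ('a \<Rightarrow> 'a) \<Rightarrow> bool" where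
  "adjoint_pair f g \<longleftrightarrow> (\<forall>x y. cinner (f x) y = cinner x (g y))"

definition positive_op :: "('a::complex_inner \<Rightarrow> 'a) \<Rightarrow> bool" where
  "positive_op f \<longleftrightarrow> bounded_op f \<and> adjoint_pair f f \<and> (\<forall>x. 0 \<le> inner x (f x))"

lemma mem_op_of [simp]: "(x, y) \<in> op_of f \<longleftrightarrow> y = f x"
  by (simp add: op_of_def)

lemma op_of_inject [simp]: "op_of f = op_of g \<longleftrightarrow> f = g"
  by (auto simp: op_of_def set_eq_iff)

lemma op_comp_op_of [simp]: "op_of f \<circ>\<^sub>o op_of g = op_of (f \<circ> g)"
  by (auto simp: op_comp_def op_of_def)

lemma bounded_op_compose: "bounded_op f \<Longrightarrow> bounded_op g \<Longrightarrow> bounded_op (f \<circ> g)"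
  by (simp add: bounded_op_def bounded_linear_compose[of f g, folded comp_def] o_def
      bounded_linear_compose)

lemma bounded_op_bound:
  assumes "bounded_op f" obtains K where "K > 0" "\<And>x. norm (f x) \<le> K * norm x"
  using assms bounded_linear.pos_bounded unfolding bounded_op_def by (metis mult.commute)

lemma bounded_op_linear:
  assumes "bounded_op f"
  shows "f (x + y) = f x + f y" "f (x - y) = f x - f y" "f 0 = 0" "f (- x) = - f x"
    "f (r *\<^sub>R x) = r *\<^sub>R f x" "f (c *\<^sub>C x) = c *\<^sub>C f x"
  using assms linear_add[of f] linear_diff[of f] linear_0[of f] linear_cmul[of f] linear_neg[of f]
  unfolding bounded_op_def by (auto dest: bounded_linear.linear)

lemma linear_operator_op_of: "bounded_op f \<Longrightarrow> linear_operator UNIV (op_of f)"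
  by (auto simp: linear_operator_def single_valued_def bounded_op_linear)

lemma adjoint_pair_sym: "adjoint_pair f g \<Longrightarrow> adjoint_pair g f"
  unfolding adjoint_pair_def by (metis cinner_commute)

lemma adjoint_pair_compose:
  "adjoint_pair f f' \<Longrightarrow> adjoint_pair g g' \<Longrightarrow> adjoint_pair (f \<circ> g) (g' \<circ> f')"
  by (simp add: adjoint_pair_def)

lemma adjoint_pair_inner: "adjoint_pair f g \<Longrightarrow> inner (f x) y = inner x (g y)"
  unfolding adjoint_pair_def by (metis Re_cinner)

definition projection_op :: "('a::complex_inner \<Rightarrow> 'a) \<Rightarrow> bool" where
  "projection_op P \<longleftrightarrow> bounded_op P \<and> adjoint_pair P P \<and> (\<forall>x. P (P x) = P x)"

lemma symmetric_idempotent_norm_le: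
  assumes adj: "adjoint_pair P P" and PP: "\<And>x. P (P x) = P x" shows "norm (P x) \<le> norm x"
proof -
  have "(norm (P x))\<^sup>2 = inner x (P x)"
    using adjoint_pair_inner[OF adj, of x "P x"] by (simp add: PP dot_square_norm)
  also have "\<dots> \<le> norm x * norm (P x)" by (rule norm_cauchy_schwarz)
  finally show ?thesis by (cases "P x = 0") (auto simp: power2_eq_square)
qed

lemma op_adjoint_op_of:
  assumes "adjoint_pair f g" shows "op_adjoint UNIV (op_of f) = op_of g"
proof -
  have g: "cinner (g x) u = cinner x (f u)" for x u
    using adjoint_pair_sym[OF assms] by (simp add: adjoint_pair_def)
  have "(x, y) \<in> op_adjoint UNIV (op_of f) \<longleftrightarrow> y = g x" for x y
  proof -
    have "(x, y) \<in> op_adjoint UNIV (op_of f) \<longleftrightarrow> (\<forall>u. cinner (g x) u = cinner y u)"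
      by (auto simp: op_adjoint_def g)
    thus ?thesis using cinner_ext_left by metis
  qed
  thus ?thesis by auto
qed

lemma self_adjoint_op_of:
  assumes "bounded_op f" "adjoint_pair f f" shows "self_adjoint (op_of f)"
proof -
  have "Domain (op_of f) = UNIV" by auto
  thus ?thesis using assms
    by (simp add: self_adjoint_def linear_operator_op_of densely_defined_def op_adjoint_op_of)
qed

lemma positive_op_of:
  assumes "positive_op f"
  shows "self_adjoint (op_of f)" "bounded_below_by 0 (op_of f)"
proof -
  show "self_adjoint (op_of f)" using assms by (simp add: positive_op_def self_adjoint_op_of)
  have "cinner u (f u) \<in> \<real>" for u
  proof -
    have "cnj (cinner u (f u)) = cinner u (f u)"
      using assms cinner_commute unfolding positive_op_def adjoint_pair_def by metis
    thus ?thesis by (simp add: Reals_cnj_iff)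
  qed
  thus "bounded_below_by 0 (op_of f)"
    using assms by (auto simp: bounded_below_by_def positive_op_def Re_cinner)
qed

text \<open>The two bounds below only ask for positivity on a subspace \<open>V\<close>, because the eigenvalues of a compact
  operator are found on the orthogonal complement of those already known.\<close>

lemma nonneg_form_Cauchy_Schwarz:
  fixes A :: "'a::complex_inner \<Rightarrow> 'a"
  assumes A: "bounded_op A" "adjoint_pair A A" and V: "complex_vector.subspace V"
    and nn: "\<And>x. x \<in> V \<Longrightarrow> 0 \<le> inner x (A x)" and x: "x \<in> V" and y: "y \<in> V"
  shows "(inner x (A y))\<^sup>2 \<le> inner x (A x) * inner y (A y)"
proof -
  let ?a = "inner x (A x)" and ?b = "inner x (A y)" and ?c = "inner y (A y)"
  have sym: "inner y (A x) = ?b"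
    by (metis adjoint_pair_inner[OF A(2)] inner_commute)
  have q: "0 \<le> ?a + 2 * t * ?b + t\<^sup>2 * ?c" for t
  proof -
    have "0 \<le> inner (x + t *\<^sub>R y) (A (x + t *\<^sub>R y))"
      by (intro nn complex_vector.subspace_add[OF V] subspace_scaleR[OF V] x y)
    thus ?thesis
      by (simp add: bounded_op_linear[OF A(1)] inner_add_left inner_add_right sym
          power2_eq_square algebra_simps)
  qed
  show ?thesis
  proof (cases "?c = 0")
    case True
    have "?b = 0"
    proof (rule ccontr)
      assume "?b \<noteq> 0"
      thus False using q[of "- (?a + 1) / (2 * ?b)"] True by (simp add: field_simps)
    qed
    thus ?thesis using True by simp
  next
    case False
    hence c: "?c > 0" using nn[OF y] by simp
    have "0 \<le> ?a - ?b\<^sup>2 / ?c" using q[of "- ?b / ?c"] c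
      by (simp add: field_simps power2_eq_square)
    thus ?thesis using c by (simp add: field_simps)
  qed
qed

text \<open>Cauchy-Schwarz for the form, applied to \<open>A x\<close> and \<open>x\<close>, gives \<open>\<parallel>A x\<parallel>\<^sup>4 \<le> (A x, A A x) (x, A x)\<close>, and the
  first factor is at most \<open>\<mu> \<parallel>A x\<parallel>\<^sup>2\<close>.\<close>

lemma norm_le_of_form_le:
  fixes A :: "'a::complex_inner \<Rightarrow> 'a"
  assumes A: "bounded_op A" "adjoint_pair A A" and V: "complex_vector.subspace V"
    and nn: "\<And>x. x \<in> V \<Longrightarrow> 0 \<le> inner x (A x)"
    and inv: "\<And>x. x \<in> V \<Longrightarrow> A x \<in> V"
    and le: "\<And>x. x \<in> V \<Longrightarrow> inner x (A x) \<le> \<mu> * (norm x)\<^sup>2" and x: "x \<in> V"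
  shows "(norm (A x))\<^sup>2 \<le> \<mu> * inner x (A x)"
proof (cases "A x = 0")
  case True
  thus ?thesis by simp
next
  case False
  have "((norm (A x))\<^sup>2)\<^sup>2 = (inner (A x) (A x))\<^sup>2" by (simp add: dot_square_norm)
  also have "\<dots> \<le> inner (A x) (A (A x)) * inner x (A x)"
    using nonneg_form_Cauchy_Schwarz[OF A V nn inv[OF x] x] .
  also have "\<dots> \<le> (\<mu> * (norm (A x))\<^sup>2) * inner x (A x)"
    by (intro mult_right_mono le inv x nn)
  finally have "(norm (A x))\<^sup>2 * (norm (A x))\<^sup>2 \<le> (norm (A x))\<^sup>2 * (\<mu> * inner x (A x))"
    by (simp add: power2_eq_square mult_ac)
  moreover have "(norm (A x))\<^sup>2 > 0" using False by simp
  ultimately show ?thesis by (rule mult_left_le_imp_le)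
qed

lemma positive_op_norm_le:
  assumes "positive_op A" and "\<And>x. inner x (A x) \<le> \<mu> * (norm x)\<^sup>2"
  shows "(norm (A x))\<^sup>2 \<le> \<mu> * inner x (A x)"
  using norm_le_of_form_le[of A UNIV \<mu> x] assms
  by (simp add: positive_op_def complex_vector.subspace_UNIV)

lemma positive_op_form_zero:
  assumes "positive_op A" "inner x (A x) = 0" shows "A x = 0"
proof -
  have "(inner (A x) (A x))\<^sup>2 \<le> inner (A x) (A (A x)) * inner x (A x)"
    using nonneg_form_Cauchy_Schwarz[of A UNIV "A x" x] assms(1)
    by (simp add: positive_op_def complex_vector.subspace_UNIV)
  thus ?thesis using assms(2) by simp
qed


section \<open>Nonnegative self-adjoint extensions of a strictly positive operator\<close>

lemma linear_operatorD:
  assumes "linear_operator M T"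
  shows "(x, y) \<in> T \<Longrightarrow> x \<in> M" "(x, y) \<in> T \<Longrightarrow> y \<in> M"
    "(x, y) \<in> T \<Longrightarrow> (x, y') \<in> T \<Longrightarrow> y = y'" "(0, 0) \<in> T"
    "(x, y) \<in> T \<Longrightarrow> (x', y') \<in> T \<Longrightarrow> (x + x', y + y') \<in> T"
    "(x, y) \<in> T \<Longrightarrow> (c *\<^sub>C x, c *\<^sub>C y) \<in> T"
    "(x, y) \<in> T \<Longrightarrow> (x', y') \<in> T \<Longrightarrow> (x - x', y - y') \<in> T"
proof -
  show add: "(x, y) \<in> T \<Longrightarrow> (x', y') \<in> T \<Longrightarrow> (x + x', y + y') \<in> T" for x y x' y'
    using assms by (simp add: linear_operator_def)
  show scale: "(x, y) \<in> T \<Longrightarrow> (c *\<^sub>C x, c *\<^sub>C y) \<in> T" for c x y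
    using assms by (simp add: linear_operator_def)
  show "(x, y) \<in> T \<Longrightarrow> (x', y') \<in> T \<Longrightarrow> (x - x', y - y') \<in> T"
    using add[of x y "- x'" "- y'"] scale[of x' y' "-1"] by simp
qed (use assms in \<open>auto simp: linear_operator_def dest: single_valuedD\<close>)

lemma bounded_below_byD:
  assumes "bounded_below_by \<epsilon> T" "(u, v) \<in> T"
  shows "\<epsilon> * (norm u)\<^sup>2 \<le> inner u v" "Im (cinner u v) = 0"
  using assms by (auto simp: bounded_below_by_def Re_cinner complex_is_Real_iff)

lemma bounded_below_by_mono:
  assumes "bounded_below_by \<delta> T" "\<epsilon> \<le> \<delta>" shows "bounded_below_by \<epsilon> T"
proof -
  have "\<epsilon> * (norm u)\<^sup>2 \<le> \<delta> * (norm u)\<^sup>2" for u :: 'a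
    using assms(2) by (simp add: mult_right_mono)
  thus ?thesis using assms(1) unfolding bounded_below_by_def by (fastforce intro: order_trans)
qed

text \<open>The quadratic form is real, so polarisation gives \<open>Im (u, v') = Im (v, u')\<close>; the real parts follow by
  passing from \<open>u'\<close> to \<open>\<i> u'\<close>.\<close>

lemma bounded_below_symmetric:
  assumes T: "linear_operator UNIV T" and bb: "bounded_below_by \<epsilon> T"
    and uv: "(u, v) \<in> T" and uv': "(u', v') \<in> T"
  shows "cinner u v' = cinner v u'"
proof -
  have im: "Im (cinner u v') = Im (cinner v u')" if "(u, v) \<in> T" "(u', v') \<in> T" for u v u' v'
  proof -
    have "Im (cinner (u + u') (v + v')) = 0"
      using bounded_below_byD(2)[OF bb] linear_operatorD(5)[OF T] that by blast
    hence "Im (cinner u v') + Im (cinner u' v) = 0"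
      using bounded_below_byD(2)[OF bb that(1)] bounded_below_byD(2)[OF bb that(2)]
      by (simp add: cinner_algebra)
    moreover have "Im (cinner u' v) = - Im (cinner v u')"
      using cinner_commute[of u' v] by simp
    ultimately show ?thesis by simp
  qed
  have "Im (cinner u (\<i> *\<^sub>C v')) = Im (cinner v (\<i> *\<^sub>C u'))"
    using im[OF uv linear_operatorD(6)[OF T uv']] .
  hence "Re (cinner u v') = Re (cinner v u')" by (simp add: cinner_algebra)
  thus ?thesis using im[OF uv uv'] by (simp add: complex_eq_iff)
qed

lemma bounded_below_norm:
  assumes "bounded_below_by \<epsilon> T" "(u, v) \<in> T" shows "\<epsilon> * norm u \<le> norm v"
proof (cases "u = 0")
  case False
  have "norm u * (\<epsilon> * norm u) \<le> norm u * norm v"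
    using bounded_below_byD(1)[OF assms] norm_cauchy_schwarz[of u v]
    by (simp add: power2_eq_square mult_ac)
  thus ?thesis using False by (simp add: mult_left_le_imp_le)
qed simp

lemma subspace_Range:
  assumes "linear_operator UNIV T" shows "complex_vector.subspace (Range T)"
  unfolding complex_vector.subspace_def using linear_operatorD(4,5,6)[OF assms] by blast

text \<open>Since \<open>\<epsilon> \<parallel>u\<parallel> \<le> \<parallel>T u\<parallel>\<close>, the preimages of a convergent sequence in the range form a Cauchy
  sequence.\<close>

lemma closed_Range:
  fixes T :: "'a::complex_hilbert operator"
  assumes T: "linear_operator UNIV T" and cl: "closed T"
    and bb: "bounded_below_by \<epsilon> T" and e: "\<epsilon> > 0"
  shows "closed (Range T)"
  unfolding closed_sequential_limits
proof (intro allI impI, elim conjE)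
  fix y l assume "\<forall>n. y n \<in> Range T" and l: "y \<longlonglongrightarrow> l"
  then obtain x where xy: "\<And>n. (x n, y n) \<in> T" unfolding Range_iff by metis
  have le: "\<epsilon> * norm (x m - x n) \<le> norm (y m - y n)" for m n
    using bounded_below_norm[OF bb linear_operatorD(7)[OF T xy xy]] .
  have "Cauchy x"
  proof (rule metric_CauchyI)
    fix r :: real assume "0 < r"
    hence "0 < \<epsilon> * r" using e by simp
    then obtain N where N: "\<And>m n. m \<ge> N \<Longrightarrow> n \<ge> N \<Longrightarrow> dist (y m) (y n) < \<epsilon> * r"
      using metric_CauchyD[OF LIMSEQ_imp_Cauchy[OF l]] by meson
    have "dist (x m) (x n) < r" if "m \<ge> N" "n \<ge> N" for m n
    proof -
      have "\<epsilon> * norm (x m - x n) < \<epsilon> * r" using N[OF that] le[of m n] by (simp add: dist_norm)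
      thus ?thesis using e by (simp add: dist_norm)
    qed
    thus "\<exists>N. \<forall>m\<ge>N. \<forall>n\<ge>N. dist (x m) (x n) < r" by blast
  qed
  hence "convergent x" by (simp add: Cauchy_convergent_iff)
  then obtain z where "x \<longlonglongrightarrow> z" unfolding convergent_def ..
  hence "(\<lambda>n. (x n, y n)) \<longlonglongrightarrow> (z, l)" using l by (rule tendsto_Pair)
  hence "(z, l) \<in> T" by (rule closed_sequentially[OF cl xy])
  thus "l \<in> Range T" by (rule RangeI)
qed

lemma self_adjointD:
  assumes "self_adjoint T"
  shows "linear_operator UNIV T"
    and "(f, g) \<in> T \<longleftrightarrow> (\<forall>(u, v)\<in>T. cinner f v = cinner g u)"
proof -
  show "linear_operator UNIV T" using assms by (simp add: self_adjoint_def)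
  have "(f, g) \<in> T \<longleftrightarrow> (f, g) \<in> op_adjoint UNIV T" using assms by (simp add: self_adjoint_def)
  thus "(f, g) \<in> T \<longleftrightarrow> (\<forall>(u, v)\<in>T. cinner f v = cinner g u)" by (simp add: op_adjoint_def)
qed

lemma self_adjointI:
  assumes "linear_operator UNIV T" "densely_defined T"
    and "\<And>f g. (f, g) \<in> T \<longleftrightarrow> (\<forall>(u, v)\<in>T. cinner f v = cinner g u)"
  shows "self_adjoint T"
proof -
  have "(f, g) \<in> op_adjoint UNIV T \<longleftrightarrow> (f, g) \<in> T" for f g
    unfolding assms(3) by (simp add: op_adjoint_def)
  thus ?thesis using assms(1,2) by (auto simp: self_adjoint_def)
qed

lemma closed_self_adjoint:
  assumes "self_adjoint T" shows "closed (T :: 'a::complex_inner operator)"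
proof -
  have "w \<in> T \<longleftrightarrow> (\<forall>z\<in>T. cinner (fst w) (snd z) = cinner (snd w) (fst z))" for w
    using self_adjointD(2)[OF assms, of "fst w" "snd w"] by (simp add: case_prod_beta)
  hence "T = (\<Inter>z\<in>T. {w. cinner (fst w) (snd z) = cinner (snd w) (fst z)})" by blast
  moreover have "closed (\<Inter>z\<in>T. {w. cinner (fst w) (snd z) = cinner (snd w) (fst z)})"
    by (intro closed_INT ballI closed_Collect_eq continuous_intros)
  ultimately show ?thesis by simp
qed

text \<open>The range is closed, and its orthogonal complement is the kernel, which strict positivity makes
  trivial; so the range is the whole space.\<close>

lemma self_adjoint_inverse:
  fixes T :: "'a::complex_hilbert operator"
  assumes sa: "self_adjoint T" and bb: "bounded_below_by \<delta> T" and d: "\<delta> > 0"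
  obtains R where "positive_op R" "T\<inverse> = op_of R" "\<And>x. (R x, x) \<in> T"
    "\<And>x. \<delta> * (norm (R x))\<^sup>2 \<le> inner x (R x)"
proof -
  note T = self_adjointD(1)[OF sa]
  have sub: "complex_vector.subspace (Range T)" using T by (rule subspace_Range)
  have cl: "closed (Range T)" using closed_Range[OF T closed_self_adjoint[OF sa] bb d] .
  have inj: "u = 0" if "(u, 0) \<in> T" for u
    using bounded_below_norm[OF bb that] d by (simp add: mult_le_0_iff)
  have "z = 0" if "z \<in> orth_compl (Range T)" for z
  proof -
    have "cinner z v = 0" if "(u, v) \<in> T" for u v
      using \<open>z \<in> _\<close> that orth_compl_commute by blast
    hence "(z, 0) \<in> T" using self_adjointD(2)[OF sa, of z 0] by auto
    thus ?thesis by (rule inj)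
  qed
  hence "x \<in> Range T" for x
    by (metis orthogonal_decomposition[OF sub cl, of x] eq_iff_diff_eq_0)
  then obtain R where R: "\<And>x. (R x, x) \<in> T" unfolding Range_iff by metis
  have uniq: "u = R x" if "(u, x) \<in> T" for u x
    using inj[of "u - R x"] linear_operatorD(7)[OF T that R[of x]] by simp
  have form: "\<delta> * (norm (R x))\<^sup>2 \<le> inner x (R x)" for x
    using bounded_below_byD(1)[OF bb R[of x]] by (simp add: inner_commute)
  have add: "R (x + y) = R x + R y" for x y
    by (rule uniq[symmetric]) (intro linear_operatorD(5)[OF T] R)
  have scale: "R (c *\<^sub>C x) = c *\<^sub>C R x" for c x
    by (rule uniq[symmetric]) (intro linear_operatorD(6)[OF T] R)
  have "bounded_linear R"
  proof (rule bounded_linear_intro[where K = "1 / \<delta>"])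
    show "norm (R x) \<le> norm x * (1 / \<delta>)" for x
      using bounded_below_norm[OF bb R[of x]] d by (simp add: field_simps)
  qed (simp_all add: add scaleR_eq_scaleC scale)
  moreover have "adjoint_pair R R"
    unfolding adjoint_pair_def using bounded_below_symmetric[OF T bb R R] by metis
  moreover have "0 \<le> inner x (R x)" for x
  proof -
    have "0 \<le> \<delta> * (norm (R x))\<^sup>2" using d by simp
    thus ?thesis using form order_trans by blast
  qed
  ultimately have "positive_op R" by (simp add: positive_op_def bounded_op_def scale)
  moreover have "T\<inverse> = op_of R" using R uniq by auto
  ultimately show thesis using that R form by blast
qed

subsection \<open>Translates of an operator\<close>

lemma mem_op_shift [simp]: "(x, y) \<in> op_shift T c \<longleftrightarrow> (x, y - c *\<^sub>C x) \<in> T"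
proof
  assume "(x, y - c *\<^sub>C x) \<in> T"
  hence "(x, (y - c *\<^sub>C x) + c *\<^sub>C x) \<in> op_shift T c" unfolding op_shift_def by blast
  thus "(x, y) \<in> op_shift T c" by simp
qed (auto simp: op_shift_def)

lemma Domain_op_shift [simp]: "Domain (op_shift T c) = Domain T"
  unfolding op_shift_def by blast

lemma linear_operator_op_shift:
  assumes T: "linear_operator UNIV T" shows "linear_operator UNIV (op_shift T c)"
proof -
  have "(x + x', y + y') \<in> op_shift T c" if "(x, y) \<in> op_shift T c" "(x', y') \<in> op_shift T c"
    for x y x' y'
    using linear_operatorD(5)[OF T that[unfolded mem_op_shift]]
    by (simp add: scaleC_add_right algebra_simps)
  moreover have "(d *\<^sub>C x, d *\<^sub>C y) \<in> op_shift T c" if "(x, y) \<in> op_shift T c" for d x y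
    using linear_operatorD(6)[OF T that[unfolded mem_op_shift], of d]
    by (simp add: complex_vector.scale_right_diff_distrib scaleC_scaleC mult.commute)
  moreover have "single_valued (op_shift T c)"
    using linear_operatorD(3)[OF T] by (force intro: single_valuedI)
  ultimately show ?thesis using linear_operatorD(4)[OF T] by (simp add: linear_operator_def)
qed

lemma bounded_below_op_shift:
  "bounded_below_by \<epsilon> T \<Longrightarrow> bounded_below_by (\<epsilon> + a) (op_shift T (of_real a))"
  unfolding bounded_below_by_def op_shift_def
  by (auto simp: cinner_algebra cinner_self distrib_right)

lemma self_adjoint_op_shift:
  assumes sa: "self_adjoint T" shows "self_adjoint (op_shift T (of_real a))"
proof (rule self_adjointI)
  show "linear_operator UNIV (op_shift T (of_real a))"
    using linear_operator_op_shift self_adjointD(1)[OF sa] .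
  show "densely_defined (op_shift T (of_real a))"
    using sa by (simp add: densely_defined_def self_adjoint_def)
  fix f g
  have "(\<forall>(u, v)\<in>op_shift T (of_real a). cinner f v = cinner g u) \<longleftrightarrow>
        (\<forall>(u, v)\<in>T. cinner f (v + of_real a *\<^sub>C u) = cinner g u)"
    unfolding op_shift_def by blast
  also have "\<dots> \<longleftrightarrow> (\<forall>(u, v)\<in>T. cinner f v = cinner (g - of_real a *\<^sub>C f) u)"
    by (intro ball_cong) (auto simp: cinner_algebra algebra_simps)
  also have "\<dots> \<longleftrightarrow> (f, g) \<in> op_shift T (of_real a)" 
    by (simp add: self_adjointD(2)[OF sa, of f "g - of_real a *\<^sub>C f"])
  finally show "(f, g) \<in> op_shift T (of_real a) \<longleftrightarrow>
      (\<forall>(u, v)\<in>op_shift T (of_real a). cinner f v = cinner g u)" by simp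
qed

lemma closed_op_shift:
  assumes "closed (T :: 'a::complex_inner operator)" shows "closed (op_shift T c)"
proof -
  have "op_shift T c = (\<lambda>w. (fst w, snd w - c *\<^sub>C fst w)) -` T" by auto
  moreover have "continuous_on UNIV (\<lambda>w::'a \<times> 'a. (fst w, snd w - c *\<^sub>C fst w))"
    by (intro continuous_intros bounded_linear.continuous_on[OF bounded_linear_scaleC])
  ultimately show ?thesis using assms by (simp add: closed_vimage)
qed

subsection \<open>The extension that vanishes on the orthogonal complement of the range\<close>

text \<open>This is the explicit form \<open>dom(S) + ran(S)\<^sup>\<bottom>\<close> of the Krein-von Neumann extension. Here it serves
  as a competitor against which extremal extensions are compared.\<close>

definition kernel_extension :: "'a::complex_inner operator \<Rightarrow> 'a operator" where
  "kernel_extension S = {(u + n, v) | u v n. (u, v) \<in> S \<and> n \<in> orth_compl (Range S)}"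

text \<open>Self-adjointness is a direct computation. If \<open>(f, g)\<close> lies in the adjoint, testing with
  \<open>n \<in> ran(S)\<^sup>\<bottom>\<close> puts \<open>g\<close> into \<open>ran(S)\<^sup>\<bottom>\<^sup>\<bottom> = ran(S)\<close>, say \<open>g = S u\<close>; testing with \<open>dom(S)\<close> then shows that
  \<open>f - u\<close> is orthogonal to \<open>ran(S)\<close>.\<close>

lemma kernel_extension_nonneg_sa:
  fixes S :: "'a::complex_hilbert operator"
  assumes S: "linear_operator UNIV S" and dd: "densely_defined S" and cl: "closed S"
    and bb: "bounded_below_by \<epsilon> S" and e: "\<epsilon> > 0"
  shows "nonneg_sa_extension S (kernel_extension S)"
proof -
  let ?N = "orth_compl (Range S)" and ?K = "kernel_extension S"
  have N: "complex_vector.subspace ?N" by (rule subspace_orth_compl)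
  have N0: "0 \<in> ?N" using N by (rule complex_vector.subspace_0)
  have nv: "cinner n v = 0" "cinner v n = 0" if "n \<in> ?N" "(u, v) \<in> S" for n u v
    using that orth_compl_commute[of n "Range S" v] by (auto simp: orth_compl_def)
  have KI: "(u + n, v) \<in> ?K" if "(u, v) \<in> S" "n \<in> ?N" for u v n
    using that by (auto simp: kernel_extension_def)
  have KE: "\<exists>u n. x = u + n \<and> (u, y) \<in> S \<and> n \<in> ?N" if "(x, y) \<in> ?K" for x y
    using that by (auto simp: kernel_extension_def)
  have ext: "S \<subseteq> ?K" using KI[OF _ N0] by auto
  have "single_valued ?K"
  proof (rule single_valuedI)
    fix x y y' assume "(x, y) \<in> ?K" "(x, y') \<in> ?K"
    then obtain u n u' n' where u: "x = u + n" "(u, y) \<in> S" "n \<in> ?N"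
      and u': "x = u' + n'" "(u', y') \<in> S" "n' \<in> ?N" using KE by blast
    have d: "(u - u', y - y') \<in> S" using linear_operatorD(7)[OF S u(2) u'(2)] .
    have "u - u' = n' - n" using u(1) u'(1) by (metis add.commute diff_add_eq_diff_diff_swap
          add_diff_cancel_left' add_implies_diff diff_diff_eq2)
    hence "cinner (u - u') (y - y') = 0"
      using nv(1)[OF _ d] complex_vector.subspace_diff[OF N u'(3) u(3)] by simp
    hence "inner (u - u') (y - y') = 0" by (simp add: Re_cinner[symmetric])
    hence "\<epsilon> * (norm (u - u'))\<^sup>2 \<le> 0" using bounded_below_byD(1)[OF bb d] by simp
    hence "u - u' = 0" using e by (simp add: mult_le_0_iff)
    thus "y = y'" using d linear_operatorD(3,4)[OF S] by fastforce
  qed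
  moreover have "(x + x', y + y') \<in> ?K" if xy: "(x, y) \<in> ?K" "(x', y') \<in> ?K" for x y x' y'
  proof -
    obtain u n where u: "x = u + n" "(u, y) \<in> S" "n \<in> ?N" using KE[OF xy(1)] by blast
    obtain u' n' where u': "x' = u' + n'" "(u', y') \<in> S" "n' \<in> ?N" using KE[OF xy(2)] by blast
    have "((u + u') + (n + n'), y + y') \<in> ?K"
      using KI linear_operatorD(5)[OF S u(2) u'(2)] complex_vector.subspace_add[OF N u(3) u'(3)] .
    thus ?thesis using u(1) u'(1) by (simp add: algebra_simps)
  qed
  moreover have "(c *\<^sub>C x, c *\<^sub>C y) \<in> ?K" if "(x, y) \<in> ?K" for c x y
    using KE[OF that] KI linear_operatorD(6)[OF S] complex_vector.subspace_scale[OF N]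
    by (metis scaleC_add_right)
  ultimately have lin: "linear_operator UNIV ?K"
    using ext linear_operatorD(4)[OF S] by (auto simp: linear_operator_def)
  have "closure (Domain S) \<subseteq> closure (Domain ?K)" using ext by (intro closure_mono) blast
  hence dense: "densely_defined ?K" using dd by (auto simp: densely_defined_def)
  have "self_adjoint ?K"
  proof (rule self_adjointI[OF lin dense], intro iffI)
    fix f g assume fg: "(f, g) \<in> ?K"
    then obtain u n where u: "f = u + n" "(u, g) \<in> S" "n \<in> ?N" using KE by blast
    have "cinner f y = cinner g x" if xy: "(x, y) \<in> ?K" for x y
    proof -
      obtain u' n' where u': "x = u' + n'" "(u', y) \<in> S" "n' \<in> ?N" using KE xy by blast
      have "cinner f y = cinner u y" using u(1) nv(1)[OF u(3) u'(2)] by (simp add: cinner_algebra)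
      also have "\<dots> = cinner g u'" using bounded_below_symmetric[OF S bb u(2) u'(2)] .
      also have "\<dots> = cinner g x" using u'(1) nv(2)[OF u'(3) u(2)] by (simp add: cinner_algebra)
      finally show ?thesis .
    qed
    thus "\<forall>(u, v)\<in>?K. cinner f v = cinner g u" by blast
  next
    fix f g assume fg: "\<forall>(u, v)\<in>?K. cinner f v = cinner g u"
    have "cinner n g = 0" if "n \<in> ?N" for n
    proof -
      have "cinner g n = 0" using fg KI[OF linear_operatorD(4)[OF S] that] by force
      thus ?thesis using cinner_commute[of n g] by simp
    qed
    hence "g \<in> orth_compl ?N" by (simp add: orth_compl_def)
    hence "g \<in> Range S"
      using orth_compl_orth_compl[OF subspace_Range[OF S] closed_Range[OF S cl bb e]] by simp
    then obtain u where u: "(u, g) \<in> S" by blast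
    have "cinner v (f - u) = 0" if "(x, v) \<in> S" for x v
    proof -
      have "cinner f v = cinner g x" using fg ext that by blast
      moreover have "cinner u v = cinner g x" using bounded_below_symmetric[OF S bb u that] .
      ultimately have "cinner (f - u) v = 0" by (simp add: cinner_algebra)
      thus ?thesis using cinner_commute[of v "f - u"] by simp
    qed
    hence "f - u \<in> ?N" by (auto simp: orth_compl_def)
    thus "(f, g) \<in> ?K" using KI[OF u] by force
  qed
  moreover have "bounded_below_by 0 ?K"
    unfolding bounded_below_by_def
  proof (clarify)
    fix x y assume "(x, y) \<in> ?K"
    then obtain u n where u: "x = u + n" "(u, y) \<in> S" "n \<in> ?N" using KE by blast
    have "cinner x y = cinner u y" using u(1) nv(1)[OF u(3,2)] by (simp add: cinner_algebra)
    moreover have "0 \<le> \<epsilon> * (norm u)\<^sup>2" using e by simp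
    ultimately show "cinner x y \<in> \<real> \<and> 0 * (norm x)\<^sup>2 \<le> Re (cinner x y)"
      using bounded_below_byD[OF bb u(2)] by (simp add: complex_is_Real_iff Re_cinner)
  qed
  ultimately show ?thesis using ext by (simp add: nonneg_sa_extension_def)
qed

subsection \<open>The Friedrichs extension\<close>

text \<open>Applying the previous construction to \<open>S - \<epsilon>/2\<close> and translating back gives a self-adjoint
  extension of \<open>S\<close> which is still strictly positive.\<close>

lemma strictly_positive_extension_exists:
  fixes S :: "'a::complex_hilbert operator"
  assumes S: "linear_operator UNIV S" and dd: "densely_defined S" and cl: "closed S"
    and bb: "bounded_below_by \<epsilon> S" and e: "\<epsilon> > 0"
  obtains T where "nonneg_sa_extension S T" "bounded_below_by (\<epsilon> / 2) T"
proof -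
  let ?S = "op_shift S (of_real (- (\<epsilon> / 2)))"
  let ?T = "op_shift (kernel_extension ?S) (of_real (\<epsilon> / 2))"
  have "bounded_below_by (\<epsilon> + - (\<epsilon> / 2)) ?S" by (intro bounded_below_op_shift bb)
  hence "nonneg_sa_extension ?S (kernel_extension ?S)"
    using e dd by (intro kernel_extension_nonneg_sa[where \<epsilon> = "\<epsilon> / 2"] linear_operator_op_shift S
        closed_op_shift cl) (simp_all add: densely_defined_def)
  hence K: "?S \<subseteq> kernel_extension ?S" "self_adjoint (kernel_extension ?S)"
    "bounded_below_by 0 (kernel_extension ?S)" by (simp_all add: nonneg_sa_extension_def)
  have T: "bounded_below_by (\<epsilon> / 2) ?T" using bounded_below_op_shift[OF K(3), of "\<epsilon> / 2"] by simp
  have "S \<subseteq> ?T"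
  proof
    fix w assume "w \<in> S"
    then obtain u v where w: "w = (u, v)" "(u, v) \<in> S" by (cases w) auto
    have "(u, v - of_real (\<epsilon> / 2) *\<^sub>C u) \<in> ?S" using w(2) by (simp add: complex_vector.scale_minus_left)
    thus "w \<in> ?T" using K(1) w(1) by (auto simp del: of_real_divide)
  qed
  moreover have "bounded_below_by 0 ?T" using bounded_below_by_mono[OF T] e by simp
  ultimately have "nonneg_sa_extension S ?T"
    using self_adjoint_op_shift[OF K(2)] by (simp add: nonneg_sa_extension_def del: of_real_divide)
  thus thesis using that T by blast
qed

lemma resolvent:
  fixes T :: "'a::complex_hilbert operator"
  assumes "self_adjoint T" "bounded_below_by \<delta> T" "\<delta> + a > 0"
  obtains R where "positive_op R" "(op_shift T (of_real a))\<inverse> = op_of R"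
    "\<And>x. (R x, x - a *\<^sub>R R x) \<in> T" "\<And>x. (\<delta> + a) * (norm (R x))\<^sup>2 \<le> inner x (R x)"
proof -
  obtain R where R: "positive_op R" "(op_shift T (of_real a))\<inverse> = op_of R"
    "\<And>x. (R x, x) \<in> op_shift T (of_real a)" "\<And>x. (\<delta> + a) * (norm (R x))\<^sup>2 \<le> inner x (R x)"
    using self_adjoint_inverse[OF self_adjoint_op_shift bounded_below_op_shift] assms by metis
  show thesis using that[OF R(1,2) _ R(4)] R(3) by (simp add: scaleR_eq_scaleC)
qed

text \<open>The largest extension lies above the strictly positive one just found. The order is given by the
  resolvents at \<open>-1\<close>, so the bound \<open>(SF + 1)\<^sup>-\<^sup>1 \<le> 1 / (1 + \<epsilon>/2)\<close> has to be turned back into one for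
  the form of \<open>SF\<close>. The constant \<open>\<epsilon>/2\<close> is not optimal; all that matters below is that it is
  positive.\<close>

lemma friedrichs_extension_bounded_below:
  fixes S :: "'a::complex_hilbert operator"
  assumes S: "linear_operator UNIV S" and dd: "densely_defined S" and cl: "closed S"
    and bb: "bounded_below_by \<epsilon> S" and e: "\<epsilon> > 0" and F: "friedrichs_extension S SF"
  shows "bounded_below_by (\<epsilon> / 2) SF"
proof -
  obtain T where T: "nonneg_sa_extension S T" "bounded_below_by (\<epsilon> / 2) T"
    using strictly_positive_extension_exists[OF S dd cl bb e] .
  have T_sa: "self_adjoint T" using T(1) by (simp add: nonneg_sa_extension_def)
  have SF: "self_adjoint SF" "bounded_below_by 0 SF"
    using F by (simp_all add: friedrichs_extension_def nonneg_sa_extension_def)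
  have le1: "(1 + \<epsilon> / 2) * (norm u)\<^sup>2 \<le> inner u (v + u)" if uv: "(u, v) \<in> SF" for u v
  proof -
    let ?c = "1 + \<epsilon> / 2"
    obtain R where R: "positive_op R" "(op_shift SF (of_real 1))\<inverse> = op_of R"
      "\<And>x. (R x, x - 1 *\<^sub>R R x) \<in> SF" "\<And>x. (0 + 1) * (norm (R x))\<^sup>2 \<le> inner x (R x)"
      using resolvent[OF SF, of 1] by auto
    obtain R' where R': "positive_op R'" "(op_shift T (of_real 1))\<inverse> = op_of R'"
      "\<And>x. (R' x, x - 1 *\<^sub>R R' x) \<in> T" "\<And>x. (\<epsilon> / 2 + 1) * (norm (R' x))\<^sup>2 \<le> inner x (R' x)"
      using resolvent[OF T_sa T(2), of 1] e by auto
    have "op_le (op_of R) (op_of R')"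
      using F T(1) R(2) R'(2) unfolding friedrichs_extension_def by (metis zero_less_one)
    hence le: "inner x (R x) \<le> inner x (R' x)" for x by (simp add: op_le_def Re_cinner)
    have "inner x (R' x) \<le> (1 / ?c) * (norm x)\<^sup>2" for x
    proof -
      have "norm (R' x) * (?c * norm (R' x)) \<le> norm (R' x) * norm x"
        using R'(4)[of x] norm_cauchy_schwarz[of x "R' x"] by (simp add: power2_eq_square algebra_simps)
      hence "?c * norm (R' x) \<le> norm x" by (cases "R' x = 0") (auto simp: mult_left_le_imp_le)
      hence "norm (R' x) \<le> (1 / ?c) * norm x" using e by (simp add: field_simps)
      hence "norm x * norm (R' x) \<le> norm x * ((1 / ?c) * norm x)" by (intro mult_left_mono) auto
      thus ?thesis using norm_cauchy_schwarz[of x "R' x"] by (simp add: power2_eq_square mult_ac)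
    qed
    hence "inner x (R x) \<le> (1 / ?c) * (norm x)\<^sup>2" for x using le order_trans by blast
    hence "(norm (R (v + u)))\<^sup>2 \<le> (1 / ?c) * inner (v + u) (R (v + u))"
      by (rule positive_op_norm_le[OF R(1)])
    moreover have "R (v + u) = u"
    proof -
      have "(v + u, u) \<in> (op_shift SF (of_real 1))\<inverse>" using uv by (simp add: scaleC_of_real[of 1, simplified])
      thus ?thesis unfolding R(2) by simp
    qed
    ultimately have "(norm u)\<^sup>2 \<le> (1 / ?c) * inner (v + u) u" by simp
    thus ?thesis using e by (simp add: field_simps inner_commute)
  qed
  have "\<epsilon> / 2 * (norm u)\<^sup>2 \<le> inner u v" if "(u, v) \<in> SF" for u v
    using le1[OF that] by (simp add: inner_add_right power2_norm_eq_inner algebra_simps)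
  thus ?thesis using SF(2) by (auto simp: bounded_below_by_def Re_cinner)
qed

subsection \<open>The Krein-von Neumann extension\<close>

text \<open>A self-adjoint extension \<open>T\<close> of \<open>S\<close> kills at most \<open>ran(S)\<^sup>\<bottom>\<close>, because it is contained in the adjoint of
  \<open>S\<close>. Comparing the resolvents at \<open>-1\<close> of the smallest extension and of \<open>kernel_extension S\<close> shows
  that the smallest extension kills all of it.\<close>

lemma krein_von_neumann_kernel:
  fixes S :: "'a::complex_hilbert operator"
  assumes S: "linear_operator UNIV S" and dd: "densely_defined S" and cl: "closed S"
    and bb: "bounded_below_by \<epsilon> S" and e: "\<epsilon> > 0" and K: "krein_von_neumann_extension S SK"
  shows "op_ker SK = orth_compl (Range S)"
proof
  have SK: "S \<subseteq> SK" "self_adjoint SK" "bounded_below_by 0 SK"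
    using K by (simp_all add: krein_von_neumann_extension_def nonneg_sa_extension_def)
  show "op_ker SK \<subseteq> orth_compl (Range S)"
  proof
    fix x assume "x \<in> op_ker SK"
    hence x: "(x, 0) \<in> SK" by (simp add: op_ker_def)
    have "cinner v x = 0" if "(u, v) \<in> S" for u v
      using bounded_below_symmetric[OF self_adjointD(1)[OF SK(2)] SK(3) _ x] that SK(1) by fastforce
    thus "x \<in> orth_compl (Range S)" by (auto simp: orth_compl_def)
  qed
  show "orth_compl (Range S) \<subseteq> op_ker SK"
  proof
    fix n assume n: "n \<in> orth_compl (Range S)"
    have "nonneg_sa_extension S (kernel_extension S)"
      using kernel_extension_nonneg_sa[OF S dd cl bb e] .
    hence le: "op_le ((op_shift (kernel_extension S) (of_real 1))\<inverse>) ((op_shift SK (of_real 1))\<inverse>)"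
      using K unfolding krein_von_neumann_extension_def by (metis zero_less_one)
    obtain R where R: "(op_shift SK (of_real 1))\<inverse> = op_of R" "\<And>x. (R x, x - 1 *\<^sub>R R x) \<in> SK"
      by (rule resolvent[OF SK(2,3), of 1]) simp_all
    have "(0 + n, 0) \<in> kernel_extension S"
      using n linear_operatorD(4)[OF S] unfolding kernel_extension_def by blast
    hence "(n, n) \<in> (op_shift (kernel_extension S) (of_real 1))\<inverse>"
      by (simp add: scaleC_of_real[of 1, simplified])
    moreover have "(n, R n) \<in> (op_shift SK (of_real 1))\<inverse>" unfolding R(1) by simp
    ultimately have "Re (cinner n n) \<le> Re (cinner n (R n))" using le unfolding op_le_def by blast
    hence le: "inner n n \<le> inner n (R n)" by (simp add: Re_cinner)
    define w where "w = n - R n"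
    have w: "(R n, w) \<in> SK" using R(2)[of n] by (simp add: w_def)
    have "inner w w + inner (R n) w \<le> 0"
      using le by (simp add: w_def inner_diff_left inner_diff_right inner_commute)
    moreover have "0 \<le> inner (R n) w" using bounded_below_byD(1)[OF SK(3) w] by simp
    ultimately have "inner w w \<le> 0" by linarith
    hence w0: "w = 0" by (metis inner_eq_zero_iff inner_ge_zero order_antisym)
    hence "R n = n" by (simp add: w_def)
    thus "n \<in> op_ker SK" using w w0 by (simp add: op_ker_def)
  qed
qed

text \<open>If \<open>S u = y\<close> then \<open>A y = u\<close> for every operator \<open>A\<close> that inverts an extension of \<open>S\<close>, while the
  reduced operator takes \<open>P u\<close> to \<open>y\<close>. Since the range of \<open>S\<close> is all of the orthogonal complement of
  the kernel, this determines the inverse.\<close>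

lemma reduced_operator_inverse:
  fixes S :: "'a::complex_hilbert operator"
  assumes S: "linear_operator UNIV S" and dd: "densely_defined S" and cl: "closed S"
    and bb: "bounded_below_by \<epsilon> S" and e: "\<epsilon> > 0" and K: "krein_von_neumann_extension S SK"
    and ext: "S \<subseteq> T" and A: "T\<inverse> = op_of A"
    and P: "\<And>x. P x \<in> orth_compl (op_ker SK)" "\<And>x. x - P x \<in> op_ker SK"
  shows "(reduced_operator SK)\<inverse> = {(y, P (A y)) | y. y \<in> orth_compl (op_ker SK)}"
proof -
  let ?H = "orth_compl (op_ker SK)"
  have SK: "S \<subseteq> SK" "self_adjoint SK" "bounded_below_by 0 SK"
    using K by (simp_all add: krein_von_neumann_extension_def nonneg_sa_extension_def)
  note lin = self_adjointD(1)[OF SK(2)]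
  have H: "?H = Range S"
    using krein_von_neumann_kernel[OF S dd cl bb e K]
      orth_compl_orth_compl[OF subspace_Range[OF S] closed_Range[OF S cl bb e]] by simp
  have sub: "(P (A y), y) \<in> reduced_operator SK" if "y \<in> ?H" for y
  proof -
    have "y \<in> Range S" using that H by simp
    then obtain u where u: "(u, y) \<in> S" by blast
    hence "(y, u) \<in> op_of A" using ext unfolding A[symmetric] by blast
    hence "A y = u" by simp
    moreover have "(P u, y) \<in> SK"
      using linear_operatorD(7)[OF lin, of u y "u - P u" 0] u SK(1) P(2)[of u]
      by (auto simp: op_ker_def)
    ultimately show ?thesis using P(1) by (simp add: reduced_operator_def)
  qed
  have "y \<in> ?H \<and> x = P (A y)" if xy: "(x, y) \<in> reduced_operator SK" for x y
  proof -
    have x: "(x, y) \<in> SK" "x \<in> ?H" using xy by (auto simp: reduced_operator_def)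
    have "cinner n y = 0" if "n \<in> op_ker SK" for n
      using bounded_below_symmetric[OF lin SK(3) _ x(1), of n 0] that by (simp add: op_ker_def)
    hence y: "y \<in> ?H" by (simp add: orth_compl_def)
    have "(P (A y), y) \<in> SK" using sub[OF y] by (simp add: reduced_operator_def)
    hence "x - P (A y) \<in> op_ker SK"
      using linear_operatorD(7)[OF lin x(1)] by (force simp: op_ker_def)
    moreover have "x - P (A y) \<in> ?H"
      by (intro complex_vector.subspace_diff[OF subspace_orth_compl] x P)
    ultimately have "x - P (A y) = 0" by (rule orth_compl_Int)
    thus ?thesis using y by simp
  qed
  hence "(y, x) \<in> (reduced_operator SK)\<inverse> \<longleftrightarrow> y \<in> ?H \<and> x = P (A y)" for x y
    using sub by (metis converse_iff)
  thus ?thesis by auto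
qed


section \<open>The square root of a positive operator\<close>

text \<open>The real sequence \<open>sqrt_majorant\<close> is the scalar instance, at \<open>B = 1\<close>, of the iteration
  \<open>Y\<^bsub>n+1\<^esub> = (B + Y\<^sub>n\<^sup>2) / 2\<close>, whose fixed points satisfy \<open>(1 - Y)\<^sup>2 = 1 - B\<close>.
  It controls the operator iteration for every contraction \<open>B\<close>.\<close>

fun sqrt_majorant :: "nat \<Rightarrow> real" where
  "sqrt_majorant 0 = 0"
| "sqrt_majorant (Suc n) = (1 + (sqrt_majorant n)\<^sup>2) / 2"

fun sqrt_iter :: "('a::real_vector \<Rightarrow> 'a) \<Rightarrow> nat \<Rightarrow> 'a \<Rightarrow> 'a" where
  "sqrt_iter B 0 x = 0"
| "sqrt_iter B (Suc n) x = (1/2) *\<^sub>R (B x + sqrt_iter B n (sqrt_iter B n x))"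

lemma sqrt_majorant_bounds: "0 \<le> sqrt_majorant n" "sqrt_majorant n \<le> 1"
proof (induction n)
  case (Suc n)
  { case 1 show ?case by simp }
  { case 2 have "(sqrt_majorant n)\<^sup>2 \<le> 1" using Suc by (simp add: power_le_one) thus ?case by simp }
qed simp_all

lemma sqrt_majorant_mono: "sqrt_majorant n \<le> sqrt_majorant (Suc n)"
proof -
  have "0 \<le> (1 - sqrt_majorant n)\<^sup>2" by simp
  thus ?thesis by (simp add: power2_diff)
qed

lemma bounded_op_sqrt_iter:
  assumes "bounded_op B" shows "bounded_op (sqrt_iter B n)"
proof (induction n)
  case 0
  have "sqrt_iter B 0 = (\<lambda>x. 0)" by auto
  thus ?case by (simp add: bounded_op_def)
next
  case (Suc n)
  have eq: "sqrt_iter B (Suc n) = (\<lambda>x. (1/2) *\<^sub>R (B x + sqrt_iter B n (sqrt_iter B n x)))" by auto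
  have "bounded_linear (sqrt_iter B n)" "bounded_linear B"
    using assms Suc by (simp_all add: bounded_op_def)
  hence "bounded_linear (\<lambda>x. (1/2) *\<^sub>R (B x + sqrt_iter B n (sqrt_iter B n x)))"
    by (intro bounded_linear_const_scaleR bounded_linear_add)
       (simp_all add: bounded_linear_compose)
  moreover have "(1/2) *\<^sub>R (B (c *\<^sub>C x) + sqrt_iter B n (sqrt_iter B n (c *\<^sub>C x)))
      = c *\<^sub>C (1/2) *\<^sub>R (B x + sqrt_iter B n (sqrt_iter B n x))" for c x
    using assms Suc
    by (simp add: bounded_op_def scaleR_eq_scaleC scaleC_add_right scaleC_scaleC mult.commute)
  ultimately show ?case unfolding eq bounded_op_def by blast
qed

lemma adjoint_sqrt_iter:
  assumes "adjoint_pair B B" shows "adjoint_pair (sqrt_iter B n) (sqrt_iter B n)"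
proof (induction n)
  case (Suc n)
  show ?case using assms Suc by (simp add: adjoint_pair_def cinner_algebra)
qed (simp add: adjoint_pair_def)

lemma sqrt_iter_commute:
  assumes "bounded_op B" "bounded_op R" and "\<And>x. R (B x) = B (R x)"
  shows "R (sqrt_iter B n x) = sqrt_iter B n (R x)"
proof (induction n arbitrary: x)
  case (Suc n)
  thus ?case by (simp add: bounded_op_linear[OF assms(2)] assms(3))
qed (simp add: bounded_op_linear[OF assms(2)])

lemma sqrt_iter_commute_self:
  assumes "bounded_op B"
  shows "sqrt_iter B m (sqrt_iter B n x) = sqrt_iter B n (sqrt_iter B m x)"
  by (intro sqrt_iter_commute bounded_op_sqrt_iter assms)
     (rule sqrt_iter_commute[OF assms assms, symmetric], simp)

lemma norm_sqrt_iter_le: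
  assumes "bounded_op B" "\<And>x. norm (B x) \<le> norm x"
  shows "norm (sqrt_iter B n x) \<le> sqrt_majorant n * norm x"
proof (induction n arbitrary: x)
  case (Suc n)
  have "norm (sqrt_iter B n (sqrt_iter B n x)) \<le> sqrt_majorant n * norm (sqrt_iter B n x)"
    by (rule Suc)
  also have "\<dots> \<le> sqrt_majorant n * (sqrt_majorant n * norm x)"
    by (intro mult_left_mono Suc sqrt_majorant_bounds)
  finally have "norm (B x + sqrt_iter B n (sqrt_iter B n x)) \<le> norm x + (sqrt_majorant n)\<^sup>2 * norm x"
    using norm_triangle_mono[OF assms(2)[of x]] by (simp add: power2_eq_square mult.assoc)
  thus ?case
    by (simp only: sqrt_iter.simps norm_scaleR sqrt_majorant.simps) (simp add: field_simps)
qed simp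

text \<open>Since the iterates commute, \<open>Y\<^sub>n\<^sup>2 - Y\<^bsub>n-1\<^esub>\<^sup>2 = (Y\<^sub>n + Y\<^bsub>n-1\<^esub>) (Y\<^sub>n - Y\<^bsub>n-1\<^esub>)\<close>, and the increments
  are dominated by those of the scalar iteration.\<close>

lemma norm_sqrt_iter_step:
  assumes B: "bounded_op B" "\<And>x. norm (B x) \<le> norm x"
  shows "norm (sqrt_iter B (Suc n) x - sqrt_iter B n x)
    \<le> (sqrt_majorant (Suc n) - sqrt_majorant n) * norm x"
proof (induction n arbitrary: x)
  case 0
  show ?case using B(2)[of x] by (simp add: bounded_op_linear[OF bounded_op_sqrt_iter[OF B(1)]])
next
  case (Suc n)
  let ?Y = "sqrt_iter B (Suc n)" and ?Z = "sqrt_iter B n"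
    and ?q = "sqrt_majorant (Suc n)" and ?r = "sqrt_majorant n"
  let ?d = "?Y x - ?Z x"
  note lin = bounded_op_linear[OF bounded_op_sqrt_iter[OF B(1)]]
  have "sqrt_iter B (Suc (Suc n)) x - ?Y x = (1/2) *\<^sub>R (?Y (?Y x) - ?Z (?Z x))"
    unfolding sqrt_iter.simps(2)[of B "Suc n"] sqrt_iter.simps(2)[of B n x]
    by (simp only: scaleR_diff_right[symmetric]) (simp add: algebra_simps)
  also have "?Y (?Y x) - ?Z (?Z x) = ?Y ?d + ?Z ?d"
    unfolding lin(2) by (simp only: sqrt_iter_commute_self[OF B(1), of "Suc n" n]) simp
  finally have "norm (sqrt_iter B (Suc (Suc n)) x - ?Y x) \<le> (norm (?Y ?d) + norm (?Z ?d)) / 2"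
    using norm_triangle_ineq[of "?Y ?d" "?Z ?d"] by simp
  also have "\<dots> \<le> (?q * norm ?d + ?r * norm ?d) / 2"
    by (intro divide_right_mono add_mono norm_sqrt_iter_le B) simp
  also have "\<dots> = (?q + ?r) / 2 * norm ?d" by (simp add: algebra_simps)
  also have "\<dots> \<le> (?q + ?r) / 2 * ((?q - ?r) * norm x)"
    by (intro mult_left_mono Suc divide_nonneg_pos add_nonneg_nonneg sqrt_majorant_bounds) simp
  also have "\<dots> = ((1 + ?q\<^sup>2) / 2 - (1 + ?r\<^sup>2) / 2) * norm x"
    by (simp add: power2_eq_square field_simps del: sqrt_majorant.simps)
  finally show ?case unfolding sqrt_majorant.simps(2)[symmetric] .
qed

lemma sqrt_iter_limit:
  fixes B :: "'a::complex_hilbert \<Rightarrow> 'a"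
  assumes B: "bounded_op B" "\<And>x. norm (B x) \<le> norm x"
  obtains Y where "\<And>x. (\<lambda>n. sqrt_iter B n x) \<longlonglongrightarrow> Y x"
proof -
  have inc: "incseq sqrt_majorant" using sqrt_majorant_mono by (intro incseq_SucI)
  have "convergent sqrt_majorant"
    using incseq_convergent[OF inc] sqrt_majorant_bounds(2) convergentI by metis
  hence cq: "Cauchy sqrt_majorant" by (rule convergent_Cauchy)
  have diff: "norm (sqrt_iter B (n + k) x - sqrt_iter B n x)
      \<le> (sqrt_majorant (n + k) - sqrt_majorant n) * norm x" for n k x
  proof (induction k)
    case (Suc k)
    have "norm (sqrt_iter B (Suc (n + k)) x - sqrt_iter B n x)
       \<le> (sqrt_majorant (Suc (n + k)) - sqrt_majorant (n + k)) * norm x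
        + (sqrt_majorant (n + k) - sqrt_majorant n) * norm x"
      using norm_triangle_mono[OF norm_sqrt_iter_step[OF B, of "n + k" x] Suc] by simp
    thus ?case by (simp add: algebra_simps del: sqrt_majorant.simps sqrt_iter.simps)
  qed simp
  have "convergent (\<lambda>n. sqrt_iter B n x)" for x
  proof -
    have "Cauchy (\<lambda>n. sqrt_iter B n x)"
    proof (rule metric_CauchyI)
      fix e :: real assume "0 < e"
      hence "0 < e / (norm x + 1)" by (simp add: add_nonneg_pos)
      then obtain N where N: "\<And>m n. m \<ge> N \<Longrightarrow> n \<ge> N \<Longrightarrow>
          dist (sqrt_majorant m) (sqrt_majorant n) < e / (norm x + 1)"
        using metric_CauchyD[OF cq] by meson
      have le: "dist (sqrt_iter B m x) (sqrt_iter B n x) < e" if "n \<ge> N" "m \<ge> n" for m n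
      proof -
        have "dist (sqrt_iter B m x) (sqrt_iter B n x) \<le> (sqrt_majorant m - sqrt_majorant n) * norm x"
          using diff[of n "m - n" x] that by (simp add: dist_norm)
        also have "\<dots> \<le> (sqrt_majorant m - sqrt_majorant n) * (norm x + 1)"
          using incseqD[OF inc that(2)] by (intro mult_left_mono) auto
        also have "\<dots> < e"
        proof -
          have "sqrt_majorant m - sqrt_majorant n < e / (norm x + 1)"
            using N[of m n] that by (simp add: dist_real_def)
          thus ?thesis by (simp add: pos_less_divide_eq add_nonneg_pos)
        qed
        finally show ?thesis .
      qed
      have "dist (sqrt_iter B m x) (sqrt_iter B n x) < e" if "n \<ge> N" "m \<ge> N" for m n
        using le[of n m] le[of m n] that by (metis dist_commute nle_le)
      thus "\<exists>N. \<forall>m\<ge>N. \<forall>n\<ge>N. dist (sqrt_iter B m x) (sqrt_iter B n x) < e" by blast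
    qed
    thus ?thesis by (simp add: Cauchy_convergent_iff)
  qed
  hence "(\<lambda>n. sqrt_iter B n x) \<longlonglongrightarrow> lim (\<lambda>n. sqrt_iter B n x)" for x
    by (simp add: convergent_LIMSEQ_iff)
  thus thesis by (rule that)
qed

lemma positive_contraction_complement:
  assumes A: "positive_op A" "\<And>x. norm (A x) \<le> norm x"
  defines "B \<equiv> \<lambda>x. x - A x"
  shows "positive_op B" "norm (B x) \<le> norm x"
proof -
  have form: "inner x (A x) \<le> (norm x)\<^sup>2" for x
    using norm_cauchy_schwarz[of x "A x"] mult_left_mono[OF A(2)[of x] norm_ge_zero[of x]]
    by (simp add: power2_eq_square)
  have lin: "bounded_op A" and adj: "adjoint_pair A A" using A(1) by (simp_all add: positive_op_def)
  have "bounded_op B"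
    using lin by (simp add: B_def bounded_op_def bounded_linear_sub bounded_linear_ident
        complex_vector.scale_right_diff_distrib)
  moreover have "adjoint_pair B B" using adj by (simp add: B_def adjoint_pair_def cinner_algebra)
  moreover have "0 \<le> inner x (B x)" for x
    using form[of x] by (simp add: B_def inner_diff_right dot_square_norm)
  ultimately show B: "positive_op B" by (simp add: positive_op_def)
  have "inner x (B x) \<le> 1 * (norm x)\<^sup>2" for x
    using A(1) by (simp add: B_def inner_diff_right dot_square_norm positive_op_def)
  hence "(norm (B x))\<^sup>2 \<le> inner x (B x)" using positive_op_norm_le[OF B, of 1 x] by simp
  also have "\<dots> \<le> (norm x)\<^sup>2"
    using A(1) by (simp add: B_def inner_diff_right dot_square_norm positive_op_def)
  finally show "norm (B x) \<le> norm x" by (rule power2_le_imp_le) simp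
qed

text \<open>With \<open>B = 1 - A\<close> the iteration converges to some \<open>Y\<close> with \<open>2 Y = B + Y\<^sup>2\<close>, and \<open>C = 1 - Y\<close> is the root.
  It commutes with everything that commutes with \<open>A\<close>, as each iterate is a polynomial in \<open>B\<close>; this is
  what uniqueness rests on.\<close>

lemma positive_contraction_sqrt:
  fixes A :: "'a::complex_hilbert \<Rightarrow> 'a"
  assumes A: "positive_op A" "\<And>x. norm (A x) \<le> norm x"
  obtains C where "positive_op C" "\<And>x. C (C x) = A x"
    "\<And>R x. bounded_op R \<Longrightarrow> (\<And>y. R (A y) = A (R y)) \<Longrightarrow> R (C x) = C (R x)"
proof -
  define B where "B = (\<lambda>x. x - A x)"
  have B: "positive_op B" "\<And>x. norm (B x) \<le> norm x"
    unfolding B_def using positive_contraction_complement[OF A] by blast+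
  hence Blin: "bounded_op B" and Badj: "adjoint_pair B B" by (simp_all add: positive_op_def)
  obtain Y where Y: "\<And>x. (\<lambda>n. sqrt_iter B n x) \<longlonglongrightarrow> Y x" using sqrt_iter_limit[OF Blin B(2)] by blast
  note lin = bounded_op_linear[OF bounded_op_sqrt_iter[OF Blin]]
  have itle: "norm (sqrt_iter B n x) \<le> norm x" for n x
  proof -
    have "sqrt_majorant n * norm x \<le> 1 * norm x"
      by (intro mult_right_mono sqrt_majorant_bounds) simp
    thus ?thesis using norm_sqrt_iter_le[OF Blin B(2), of n x] by simp
  qed
  have Yle: "norm (Y x) \<le> norm x" for x
    using LIMSEQ_le_const2[OF tendsto_norm[OF Y[of x]], of "norm x"] itle by blast
  have Yadd: "Y (x + y) = Y x + Y y" for x y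
  proof (rule LIMSEQ_unique[OF Y])
    show "(\<lambda>n. sqrt_iter B n (x + y)) \<longlonglongrightarrow> Y x + Y y"
      unfolding lin by (intro tendsto_add Y)
  qed
  have Yscale: "Y (c *\<^sub>C x) = c *\<^sub>C Y x" for c x
  proof (rule LIMSEQ_unique[OF Y])
    show "(\<lambda>n. sqrt_iter B n (c *\<^sub>C x)) \<longlonglongrightarrow> c *\<^sub>C Y x"
      unfolding lin by (intro bounded_linear.tendsto[OF bounded_linear_scaleC] Y)
  qed
  have Ylin: "bounded_op Y"
    unfolding bounded_op_def
  proof (intro conjI allI Yscale bounded_linear_intro[where K = 1])
    show "Y (r *\<^sub>R x) = r *\<^sub>R Y x" for r x by (simp add: scaleR_eq_scaleC Yscale)
  qed (simp_all add: Yadd Yle)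
  have Yadj: "adjoint_pair Y Y"
    unfolding adjoint_pair_def
  proof (intro allI)
    fix x y
    have "cinner (sqrt_iter B n x) y = cinner x (sqrt_iter B n y)" for n
      using adjoint_sqrt_iter[OF Badj] by (simp add: adjoint_pair_def)
    moreover have "(\<lambda>n. cinner (sqrt_iter B n x) y) \<longlonglongrightarrow> cinner (Y x) y"
      by (intro tendsto_intros Y)
    moreover have "(\<lambda>n. cinner x (sqrt_iter B n y)) \<longlonglongrightarrow> cinner x (Y y)"
      by (intro tendsto_intros Y)
    ultimately show "cinner (Y x) y = cinner x (Y y)" using LIMSEQ_unique by simp
  qed
  have YY: "(\<lambda>n. sqrt_iter B n (sqrt_iter B n x)) \<longlonglongrightarrow> Y (Y x)" for x
  proof -
    have "(\<lambda>n. sqrt_iter B n (sqrt_iter B n x - Y x)) \<longlonglongrightarrow> 0"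
    proof (rule tendsto_norm_zero_cancel, rule tendsto_sandwich[OF _ _ tendsto_const])
      show "(\<lambda>n. norm (sqrt_iter B n x - Y x)) \<longlonglongrightarrow> 0"
        using tendsto_norm[OF tendsto_diff[OF Y tendsto_const], of x "Y x"] by simp
    qed (use itle in auto)
    from tendsto_add[OF this Y[of "Y x"]] show ?thesis by (simp add: lin)
  qed
  have fixpoint: "Y x = (1/2) *\<^sub>R (B x + Y (Y x))" for x
  proof (rule LIMSEQ_unique)
    show "(\<lambda>n. sqrt_iter B (Suc n) x) \<longlonglongrightarrow> Y x" using Y by (rule LIMSEQ_Suc)
    show "(\<lambda>n. sqrt_iter B (Suc n) x) \<longlonglongrightarrow> (1/2) *\<^sub>R (B x + Y (Y x))"
      by (simp, intro tendsto_intros YY)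
  qed
  define C where "C = (\<lambda>x. x - Y x)"
  note Ysimps = bounded_op_linear[OF Ylin]
  have "bounded_op C"
    using Ylin by (simp add: C_def bounded_op_def bounded_linear_sub bounded_linear_ident
        complex_vector.scale_right_diff_distrib)
  moreover have "adjoint_pair C C" using Yadj by (simp add: C_def adjoint_pair_def cinner_algebra)
  moreover have "0 \<le> inner x (C x)" for x
  proof -
    have "inner x (Y x) \<le> norm x * norm x"
      using norm_cauchy_schwarz[of x "Y x"] mult_left_mono[OF Yle[of x] norm_ge_zero[of x]] by simp
    thus ?thesis by (simp add: C_def inner_diff_right dot_square_norm power2_eq_square)
  qed
  ultimately have 1: "positive_op C" by (simp add: positive_op_def)
  have 2: "C (C x) = A x" for x
  proof -
    have "2 *\<^sub>R Y x = B x + Y (Y x)" by (subst fixpoint) simp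
    moreover have "C (C x) = x - 2 *\<^sub>R Y x + Y (Y x)"
      by (simp add: C_def Ysimps scaleR_2 algebra_simps)
    ultimately show ?thesis by (simp add: B_def)
  qed
  have 3: "R (C x) = C (R x)" if R: "bounded_op R" "\<And>y. R (A y) = A (R y)" for R x
  proof -
    have "R (B y) = B (R y)" for y using R(2) by (simp add: B_def bounded_op_linear[OF R(1)])
    hence com: "R (sqrt_iter B n x) = sqrt_iter B n (R x)" for n
      by (intro sqrt_iter_commute Blin R(1))
    have "(\<lambda>n. R (sqrt_iter B n x)) \<longlonglongrightarrow> R (Y x)"
      using R(1) Y bounded_linear.tendsto unfolding bounded_op_def by blast
    hence "R (Y x) = Y (R x)" using Y[of "R x"] com LIMSEQ_unique by simp
    thus ?thesis by (simp add: C_def bounded_op_linear[OF R(1)])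
  qed
  show thesis using that[of C] 1 2 3 by blast
qed

lemma positive_op_scale:
  assumes A: "positive_op A" and c: "0 \<le> c" shows "positive_op (\<lambda>x. c *\<^sub>R A x)"
proof -
  have "bounded_op (\<lambda>x. c *\<^sub>R A x)"
    using A unfolding positive_op_def bounded_op_def
    by (simp add: bounded_linear_const_scaleR) (simp add: scaleR_eq_scaleC scaleC_scaleC mult.commute)
  moreover have "adjoint_pair (\<lambda>x. c *\<^sub>R A x) (\<lambda>x. c *\<^sub>R A x)"
    using A by (simp add: positive_op_def adjoint_pair_def)
  ultimately show ?thesis using A c by (simp add: positive_op_def)
qed

lemma positive_op_sqrt_exists:
  fixes A :: "'a::complex_hilbert \<Rightarrow> 'a"
  assumes A: "positive_op A"
  obtains C where "positive_op C" "\<And>x. C (C x) = A x"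
    "\<And>R x. bounded_op R \<Longrightarrow> (\<And>y. R (A y) = A (R y)) \<Longrightarrow> R (C x) = C (R x)"
proof -
  have Alin: "bounded_op A" using A by (simp add: positive_op_def)
  obtain K where K: "K > 0" "\<And>x. norm (A x) \<le> K * norm x" using bounded_op_bound[OF Alin] by blast
  define A' where "A' = (\<lambda>x. (1 / K) *\<^sub>R A x)"
  have "positive_op A'" unfolding A'_def using A K(1) by (intro positive_op_scale) auto
  moreover have "norm (A' x) \<le> norm x" for x
    using K(2)[of x] K(1) by (simp add: A'_def field_simps)
  ultimately obtain C where C: "positive_op C" "\<And>x. C (C x) = A' x"
    "\<And>R x. bounded_op R \<Longrightarrow> (\<And>y. R (A' y) = A' (R y)) \<Longrightarrow> R (C x) = C (R x)"
    using positive_contraction_sqrt[of A'] by blast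
  have Clin: "bounded_op C" using C(1) by (simp add: positive_op_def)
  define C' where "C' = (\<lambda>x. sqrt K *\<^sub>R C x)"
  have "positive_op C'" unfolding C'_def using C(1) K(1) by (intro positive_op_scale) auto
  moreover have "C' (C' x) = A x" for x
    using K(1) by (simp add: C'_def bounded_op_linear[OF Clin] C(2) A'_def)
  moreover have "R (C' x) = C' (R x)" if R: "bounded_op R" "\<And>y. R (A y) = A (R y)" for R x
  proof -
    have "R (A' y) = A' (R y)" for y using R(2) by (simp add: A'_def bounded_op_linear[OF R(1)])
    thus ?thesis using C(3)[OF R(1)] by (simp add: C'_def bounded_op_linear[OF R(1)])
  qed
  ultimately show thesis using that by blast
qed

text \<open>Two commuting positive square roots \<open>C\<close>, \<open>R\<close> of \<open>A\<close> agree: for \<open>y = C x - R x\<close> the vector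
  \<open>(C + R) y = (C\<^sup>2 - R\<^sup>2) x\<close> vanishes, so both forms vanish at \<open>y\<close> and \<open>C y = R y = 0\<close>.\<close>

lemma positive_sqrt_unique:
  assumes C: "positive_op C" and R: "positive_op R"
    and sq: "\<And>x. C (C x) = R (R x)" and com: "\<And>x. R (C x) = C (R x)"
  shows "R = C"
proof
  fix x
  have lin: "bounded_op C" "bounded_op R" and adj: "adjoint_pair C C" "adjoint_pair R R"
    using C R by (simp_all add: positive_op_def)
  note s = bounded_op_linear[OF lin(1)] bounded_op_linear[OF lin(2)]
  define y where "y = C x - R x"
  have "C y + R y = 0" by (simp add: y_def s sq com)
  hence "inner y (C y) + inner y (R y) = 0" by (metis inner_add_right inner_zero_right)
  moreover have "0 \<le> inner y (C y)" "0 \<le> inner y (R y)" using C R by (simp_all add: positive_op_def)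
  ultimately have "inner y (C y) = 0" "inner y (R y) = 0" by linarith+
  hence "C y = 0" "R y = 0" using positive_op_form_zero C R by blast+
  hence "C y - R y = 0" by simp
  moreover have "inner y y = inner x (C y - R y)"
  proof -
    have "inner y y = inner (C x) y - inner (R x) y" by (simp add: y_def inner_diff_left)
    thus ?thesis by (simp add: adjoint_pair_inner[OF adj(1)] adjoint_pair_inner[OF adj(2)] inner_diff_right)
  qed
  ultimately have "y = 0" by simp
  thus "R x = C x" by (simp add: y_def)
qed

text \<open>A self-adjoint operator whose square is everywhere defined is bounded, because
  \<open>\<parallel>R x\<parallel>\<^sup>2 = (x, R\<^sup>2 x)\<close>; hence unbounded competitors for the square root do not occur.\<close>

lemma self_adjoint_sqrt_bounded:
  assumes R: "self_adjoint R" "bounded_below_by 0 R" and sq: "R \<circ>\<^sub>o R = op_of A"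
    and A: "bounded_op (A :: 'a::complex_inner \<Rightarrow> 'a)"
  obtains f where "R = op_of f" "positive_op f" "\<And>x. f (f x) = A x"
proof -
  have lin: "linear_operator UNIV R" using R(1) by (simp add: self_adjoint_def)
  have dom: "\<exists>y. (x, y) \<in> R \<and> (y, A x) \<in> R" for x
  proof -
    have "(x, A x) \<in> R \<circ>\<^sub>o R" by (simp add: sq)
    thus ?thesis by (auto simp: op_comp_def)
  qed
  then obtain f where f: "\<And>x. (x, f x) \<in> R" "\<And>x. (f x, A x) \<in> R" by metis
  have sv: "y = f x" if "(x, y) \<in> R" for x y
    using lin f(1) that by (auto simp: linear_operator_def dest: single_valuedD)
  have Rf: "R = op_of f" using f(1) sv by auto
  have ff: "f (f x) = A x" for x using sv[OF f(2)] by simp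
  have add: "f (x + y) = f x + f y" for x y
    using lin f(1) by (intro sv[symmetric]) (simp add: linear_operator_def)
  have scale: "f (c *\<^sub>C x) = c *\<^sub>C f x" for c x
    using lin f(1) by (intro sv[symmetric]) (simp add: linear_operator_def)
  have "op_adjoint UNIV R = R" using R(1) by (simp add: self_adjoint_def)
  hence "(x, f x) \<in> op_adjoint UNIV (op_of f)" for x using f(1) Rf by simp
  hence adj: "adjoint_pair f f" by (simp add: op_adjoint_def adjoint_pair_def op_of_def)
  obtain K where K: "K > 0" "\<And>x. norm (A x) \<le> K * norm x" using bounded_op_bound[OF A] by blast
  have bd: "norm (f x) \<le> norm x * sqrt K" for x
  proof -
    have "(norm (f x))\<^sup>2 = inner x (A x)"
      using adjoint_pair_inner[OF adj, of x "f x"] ff by (simp add: dot_square_norm)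
    also have "\<dots> \<le> norm x * norm (A x)" by (rule norm_cauchy_schwarz)
    also have "\<dots> \<le> norm x * (K * norm x)" by (intro mult_left_mono K) simp
    also have "\<dots> = (norm x * sqrt K)\<^sup>2" using K(1) by (simp add: power_mult_distrib power2_eq_square)
    finally show ?thesis using K(1) by (intro power2_le_imp_le[of "norm (f x)"]) auto
  qed
  have "bounded_linear f"
    by (rule bounded_linear_intro[where K = "sqrt K"]) (simp_all add: add scaleR_eq_scaleC scale bd)
  moreover have "0 \<le> inner x (f x)" for x
    using R(2) f(1)[of x] by (force simp: bounded_below_by_def Re_cinner)
  ultimately have "positive_op f" using adj by (simp add: positive_op_def bounded_op_def scale)
  thus thesis using that Rf ff by blast
qed

lemma op_sqrt_op_of:
  fixes A :: "'a::complex_hilbert \<Rightarrow> 'a"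
  assumes A: "positive_op A"
  obtains C where "positive_op C" "\<And>x. C (C x) = A x" "op_sqrt (op_of A) = op_of C"
proof -
  obtain C where C: "positive_op C" "\<And>x. C (C x) = A x"
    "\<And>R x. bounded_op R \<Longrightarrow> (\<And>y. R (A y) = A (R y)) \<Longrightarrow> R (C x) = C (R x)"
    using positive_op_sqrt_exists[OF A] by blast
  have Alin: "bounded_op A" using A by (simp add: positive_op_def)
  have "op_sqrt (op_of A) = op_of C"
    unfolding op_sqrt_def
  proof (rule the_equality)
    have "C \<circ> C = A" using C(2) by auto
    thus "self_adjoint (op_of C) \<and> bounded_below_by 0 (op_of C) \<and> op_of C \<circ>\<^sub>o op_of C = op_of A"
      using positive_op_of[OF C(1)] by simp
    fix R assume "self_adjoint R \<and> bounded_below_by 0 R \<and> R \<circ>\<^sub>o R = op_of A"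
    then obtain f where f: "R = op_of f" "positive_op f" "\<And>x. f (f x) = A x"
      using self_adjoint_sqrt_bounded[OF _ _ _ Alin] by blast
    have "f (A x) = A (f x)" for x by (simp flip: f(3))
    hence "f (C x) = C (f x)" for x using C(3)[of f] f(2) by (simp add: positive_op_def)
    hence "f = C" using C(2) f(3) by (intro positive_sqrt_unique C(1) f(2)) auto
    thus "R = op_of C" using f(1) by simp
  qed
  thus thesis using that C by blast
qed


section \<open>Compactness\<close>

lemma compact_closure_subsequence:
  assumes "compact (closure S)" "\<And>n. x n \<in> (S :: 'a::metric_space set)"
  obtains r :: "nat \<Rightarrow> nat" and l where "strict_mono r" "(x \<circ> r) \<longlonglongrightarrow> l"
proof -
  have "\<forall>n. x n \<in> closure S" using assms(2) closure_subset by blast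
  thus thesis using assms(1) that unfolding compact_def by blast
qed

lemma compact_closureI_subsequence:
  fixes S :: "'a::complete_space set"
  assumes "\<And>x. (\<And>n. x n \<in> S) \<Longrightarrow> \<exists>r::nat\<Rightarrow>nat. strict_mono r \<and> Cauchy (x \<circ> r)"
  shows "compact (closure S)"
  unfolding compact_def
proof (intro allI impI)
  fix y :: "nat \<Rightarrow> 'a" assume "\<forall>n. y n \<in> closure S"
  moreover have "0 < 1 / (real n + 1)" for n by (simp add: add_nonneg_pos)
  ultimately have "\<forall>n. \<exists>x. x \<in> S \<and> dist x (y n) < 1 / (real n + 1)"
    unfolding closure_approachable by blast
  then obtain x where x: "\<And>n. x n \<in> S" "\<And>n. dist (x n) (y n) < 1 / (real n + 1)" by metis
  have "\<exists>r::nat\<Rightarrow>nat. strict_mono r \<and> Cauchy (x \<circ> r)" using x(1) by (rule assms)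
  then obtain r :: "nat \<Rightarrow> nat" where r: "strict_mono r" "Cauchy (x \<circ> r)" by blast
  obtain l where l: "(x \<circ> r) \<longlonglongrightarrow> l"
    using r(2) unfolding Cauchy_convergent_iff convergent_def by blast
  have "(\<lambda>n. dist ((x \<circ> r) n) ((y \<circ> r) n)) \<longlonglongrightarrow> 0"
  proof (rule tendsto_sandwich[OF _ _ tendsto_const])
    show "(\<lambda>n. 1 / (real n + 1)) \<longlonglongrightarrow> 0"
      using LIMSEQ_inverse_real_of_nat by (simp add: inverse_eq_divide add.commute)
    have "dist (x (r n)) (y (r n)) \<le> 1 / (real n + 1)" for n
    proof -
      have "1 / (real (r n) + 1) \<le> 1 / (real n + 1)"
        using seq_suble[OF r(1), of n] by (intro divide_left_mono) auto
      thus ?thesis using x(2)[of "r n"] by linarith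
    qed
    thus "\<forall>\<^sub>F n in sequentially. dist ((x \<circ> r) n) ((y \<circ> r) n) \<le> 1 / (real n + 1)" by simp
  qed simp
  from tendsto_add[OF this tendsto_dist_iff[THEN iffD1, OF l]]
  have "(\<lambda>n. dist ((x \<circ> r) n) ((y \<circ> r) n) + dist ((x \<circ> r) n) l) \<longlonglongrightarrow> 0" by simp
  hence "(\<lambda>n. dist ((y \<circ> r) n) l) \<longlonglongrightarrow> 0"
    by (rule tendsto_sandwich[rotated 2, OF tendsto_const]) (simp_all add: dist_triangle3)
  hence yl: "(y \<circ> r) \<longlonglongrightarrow> l" by (rule tendsto_dist_iff[THEN iffD2])
  have "l \<in> closure S"
    unfolding closure_sequential using x(1) l by (intro exI[of _ "x \<circ> r"]) simp
  thus "\<exists>l\<in>closure S. \<exists>r. strict_mono r \<and> (y \<circ> r) \<longlonglongrightarrow> l"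
    using r(1) yl by (intro bexI[of _ l] exI[of _ r] conjI)
qed

text \<open>Compactness is passed from one operator to another through this criterion: \<open>g\<close> is uniformly
  continuous with respect to the pseudometric that \<open>f\<close> induces on \<open>B\<close>.\<close>

lemma compact_closure_dominated:
  fixes f :: "'b \<Rightarrow> 'a::metric_space" and g :: "'b \<Rightarrow> 'c::complete_space"
  assumes f: "compact (closure (f ` B))"
    and dom: "\<And>e. e > 0 \<Longrightarrow> \<exists>d>0. \<forall>x\<in>B. \<forall>y\<in>B. dist (f x) (f y) < d \<longrightarrow> dist (g x) (g y) < e"
  shows "compact (closure (g ` B))"
proof (rule compact_closureI_subsequence)
  fix y :: "nat \<Rightarrow> 'c" assume "\<And>n. y n \<in> g ` B"
  hence "\<forall>n. \<exists>x. x \<in> B \<and> y n = g x" by blast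
  then obtain x where x: "\<And>n. x n \<in> B" "\<And>n. y n = g (x n)" by metis
  obtain r :: "nat \<Rightarrow> nat" and l where r: "strict_mono r" "((\<lambda>n. f (x n)) \<circ> r) \<longlonglongrightarrow> l"
    using compact_closure_subsequence[OF f, where x = "\<lambda>n. f (x n)"] x(1) by blast
  have "Cauchy (y \<circ> r)"
  proof (rule metric_CauchyI)
    fix e :: real assume "e > 0"
    then obtain d where d: "d > 0" "\<And>u v. u \<in> B \<Longrightarrow> v \<in> B \<Longrightarrow> dist (f u) (f v) < d \<Longrightarrow> dist (g u) (g v) < e"
      using dom by metis
    obtain N where N: "\<And>m n. m \<ge> N \<Longrightarrow> n \<ge> N \<Longrightarrow> dist (f (x (r m))) (f (x (r n))) < d"
      using metric_CauchyD[OF LIMSEQ_imp_Cauchy[OF r(2)] d(1)] by auto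
    have "dist ((y \<circ> r) m) ((y \<circ> r) n) < e" if "m \<ge> N" "n \<ge> N" for m n
      using d(2)[OF x(1) x(1) N[OF that]] by (simp add: x(2))
    thus "\<exists>N. \<forall>m\<ge>N. \<forall>n\<ge>N. dist ((y \<circ> r) m) ((y \<circ> r) n) < e" by blast
  qed
  thus "\<exists>r::nat \<Rightarrow> nat. strict_mono r \<and> Cauchy (y \<circ> r)" using r(1) by blast
qed

lemma compact_image_subsequence:
  fixes f :: "'a::complex_hilbert \<Rightarrow> 'a"
  assumes "compact (closure (f ` cball 0 1))" "\<And>n. norm (x n) \<le> 1"
  obtains r :: "nat \<Rightarrow> nat" and l where "strict_mono r" "(\<lambda>n. f (x (r n))) \<longlonglongrightarrow> l"
proof -
  have "f (x n) \<in> f ` cball 0 1" for n using assms(2) by simp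
  thus thesis
    using compact_closure_subsequence[OF assms(1), where x = "\<lambda>n. f (x n)"] that
    unfolding o_def by blast
qed

lemma compact_operator_op_of:
  assumes "bounded_op f"
  shows "compact_operator UNIV (op_of f) \<longleftrightarrow> compact (closure (f ` cball 0 1))"
proof -
  have "op_of f `` (UNIV \<inter> cball 0 1) = f ` cball 0 1" by (auto simp: op_of_def)
  moreover have "Domain (op_of f) = UNIV" by (auto simp: op_of_def)
  ultimately show ?thesis using linear_operator_op_of[OF assms] by (simp add: compact_operator_def)
qed

lemma compact_compose_left:
  fixes f g :: "'a::complex_hilbert \<Rightarrow> 'a"
  assumes g: "bounded_op g" and f: "compact (closure (f ` cball 0 1))"
  shows "compact (closure ((g \<circ> f) ` cball 0 1))"
proof (rule compact_closure_dominated[OF f])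
  obtain K where K: "K > 0" "\<And>x. norm (g x) \<le> K * norm x" using bounded_op_bound[OF g] by blast
  fix e :: real assume e: "e > 0"
  have "dist ((g \<circ> f) x) ((g \<circ> f) y) < e" if "dist (f x) (f y) < e / K" for x y
    using K(2)[of "f x - f y"] that K(1)
    by (simp add: dist_norm bounded_op_linear[OF g] field_simps)
  thus "\<exists>d>0. \<forall>x\<in>cball 0 1. \<forall>y\<in>cball 0 1. dist (f x) (f y) < d \<longrightarrow>
      dist ((g \<circ> f) x) ((g \<circ> f) y) < e"
    using e K(1) by (intro exI[of _ "e / K"]) simp
qed

lemma compact_closure_mono:
  "A \<subseteq> B \<Longrightarrow> compact (closure B) \<Longrightarrow> compact (closure (A :: 'a::metric_space set))"
  by (metis closed_closure closure_mono compact_Int_closed inf.absorb_iff2)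

lemma compact_compose_right:
  fixes f g :: "'a::complex_hilbert \<Rightarrow> 'a"
  assumes f: "bounded_op f" and g: "bounded_op g" and cpt: "compact (closure (f ` cball 0 1))"
  shows "compact (closure ((f \<circ> g) ` cball 0 1))"
proof -
  obtain K where K: "K > 0" "\<And>x. norm (g x) \<le> K * norm x" using bounded_op_bound[OF g] by blast
  let ?h = "\<lambda>x. f ((1 / K) *\<^sub>R g x)"
  have "norm ((1 / K) *\<^sub>R g x) \<le> 1" if "norm x \<le> 1" for x
  proof -
    have "norm (g x) \<le> K" using K(2)[of x] mult_left_mono[OF that, of K] K(1) by linarith
    thus ?thesis using K(1) by simp
  qed
  hence "?h ` cball 0 1 \<subseteq> f ` cball 0 1" by auto
  hence "compact (closure (?h ` cball 0 1))" using cpt by (rule compact_closure_mono)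
  moreover have "bounded_op (\<lambda>x. K *\<^sub>R x)"
    unfolding bounded_op_def
    by (simp add: bounded_linear_scaleR_right) (simp add: scaleR_eq_scaleC scaleC_scaleC mult.commute)
  ultimately have "compact (closure (((\<lambda>x. K *\<^sub>R x) \<circ> ?h) ` cball 0 1))" by (intro compact_compose_left)
  moreover have "(\<lambda>x. K *\<^sub>R x) \<circ> ?h = f \<circ> g" using K(1) by (auto simp: bounded_op_linear[OF f])
  ultimately show ?thesis by simp
qed

text \<open>\<open>\<parallel>T (x - y)\<parallel>\<^sup>2 = (x - y, T\<^sup>*T (x - y)) \<le> 2 \<parallel>T\<^sup>*T x - T\<^sup>*T y\<parallel>\<close> on the unit ball.\<close>

lemma compact_gram_iff:
  fixes T T' :: "'a::complex_hilbert \<Rightarrow> 'a"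
  assumes T: "bounded_op T" "bounded_op T'" "adjoint_pair T T'"
  shows "compact (closure ((T' \<circ> T) ` cball 0 1)) \<longleftrightarrow> compact (closure (T ` cball 0 1))"
proof
  assume "compact (closure ((T' \<circ> T) ` cball 0 1))"
  thus "compact (closure (T ` cball 0 1))"
  proof (rule compact_closure_dominated)
    fix e :: real assume e: "e > 0"
    have "dist (T x) (T y) < e"
      if x: "x \<in> cball 0 1" and y: "y \<in> cball 0 1" and d: "dist ((T' \<circ> T) x) ((T' \<circ> T) y) < e\<^sup>2 / 2"
      for x y
    proof -
      have n2: "norm (x - y) \<le> 2" using norm_triangle_ineq4[of x y] x y by simp
      have "(norm (T (x - y)))\<^sup>2 = inner (x - y) (T' (T (x - y)))"
        using adjoint_pair_inner[OF T(3), of "x - y" "T (x - y)"] by (simp add: dot_square_norm)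
      also have "\<dots> \<le> norm (x - y) * norm (T' (T (x - y)))" by (rule norm_cauchy_schwarz)
      also have "\<dots> \<le> 2 * norm (T' (T (x - y)))" by (intro mult_right_mono n2) simp
      also have "\<dots> < e\<^sup>2"
        using d by (simp add: dist_norm bounded_op_linear[OF T(1)] bounded_op_linear[OF T(2)])
      finally have "norm (T (x - y)) < e" using e by (simp add: power_less_imp_less_base)
      thus ?thesis by (simp add: dist_norm bounded_op_linear[OF T(1)])
    qed
    thus "\<exists>d>0. \<forall>x\<in>cball 0 1. \<forall>y\<in>cball 0 1. dist ((T' \<circ> T) x) ((T' \<circ> T) y) < d \<longrightarrow>
        dist (T x) (T y) < e"
      using e by (intro exI[of _ "e\<^sup>2 / 2"]) simp
  qed
qed (rule compact_compose_left[OF T(2)])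


section \<open>Eigenvalues of compact positive operators\<close>

definition form_sup :: "('a::complex_inner \<Rightarrow> 'a) \<Rightarrow> 'a set \<Rightarrow> real" where
  "form_sup X F = (SUP x \<in> orth_compl F \<inter> cball 0 1. inner x (X x))"

lemma form_sup_bdd:
  assumes "bounded_op X" shows "bdd_above ((\<lambda>x. inner x (X x)) ` (orth_compl F \<inter> cball 0 1))"
proof -
  obtain K where K: "K > 0" "\<And>x. norm (X x) \<le> K * norm x" using bounded_op_bound[OF assms] by blast
  have "inner x (X x) \<le> K" if "norm x \<le> 1" for x
  proof -
    have "inner x (X x) \<le> norm x * norm (X x)" by (rule norm_cauchy_schwarz)
    also have "norm (X x) \<le> K" using K(2)[of x] mult_left_mono[OF that, of K] K(1) by linarith
    hence "norm x * norm (X x) \<le> 1 * K" using that by (intro mult_mono) auto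
    finally show ?thesis by simp
  qed
  thus ?thesis by (intro bdd_aboveI2[of _ _ K]) simp
qed

lemma zero_in_orth_compl: "0 \<in> orth_compl F \<inter> cball 0 1"
  by (simp add: orth_compl_def)

lemma form_sup_nonneg: "bounded_op X \<Longrightarrow> 0 \<le> form_sup X F"
  unfolding form_sup_def
  using cSUP_upper[OF zero_in_orth_compl form_sup_bdd, of X F] by simp

lemma form_sup_antimono:
  assumes "bounded_op X" "F \<subseteq> G" shows "form_sup X G \<le> form_sup X F"
  unfolding form_sup_def
proof (intro cSUP_subset_mono form_sup_bdd assms(1) order_refl)
  show "orth_compl G \<inter> cball 0 1 \<noteq> {}" using zero_in_orth_compl by blast
qed (use assms(2) in \<open>auto simp: orth_compl_def\<close>)

lemma form_le_form_sup:
  assumes "bounded_op X" "x \<in> orth_compl F" shows "inner x (X x) \<le> form_sup X F * (norm x)\<^sup>2"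
proof (cases "x = 0")
  case False
  define u where "u = (1 / norm x) *\<^sub>R x"
  have "u \<in> orth_compl F \<inter> cball 0 1"
    using False subspace_scaleR[OF subspace_orth_compl assms(2)] by (simp add: u_def)
  hence "inner u (X u) \<le> form_sup X F"
    unfolding form_sup_def by (rule cSUP_upper[OF _ form_sup_bdd[OF assms(1)]])
  moreover have "inner u (X u) * (norm x)\<^sup>2 = inner x (X x)"
    using False by (simp add: u_def bounded_op_linear[OF assms(1)] power2_eq_square field_simps)
  ultimately show ?thesis using mult_right_mono[of "inner u (X u)" "form_sup X F" "(norm x)\<^sup>2"] by simp
qed simp

text \<open>A maximising sequence \<open>x\<^sub>n\<close> for the form on the orthogonal complement \<open>V\<close> of some eigenvectors
  satisfies \<open>X x\<^sub>n - \<mu> x\<^sub>n \<rightarrow> 0\<close>, because \<open>\<parallel>X x\<parallel>\<^sup>2 \<le> \<mu> (x, X x)\<close> on the invariant subspace \<open>V\<close>; compactness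
  then makes a subsequence converge.\<close>

lemma form_sup_eigenvector:
  fixes X :: "'a::complex_hilbert \<Rightarrow> 'a"
  assumes X: "positive_op X" and cpt: "compact (closure (X ` cball 0 1))"
    and F: "\<And>f. f \<in> F \<Longrightarrow> \<exists>c::real. X f = c *\<^sub>R f" and pos: "form_sup X F > 0"
  obtains e where "e \<in> orth_compl F" "norm e = 1" "X e = form_sup X F *\<^sub>R e"
proof -
  let ?V = "orth_compl F" and ?m = "form_sup X F"
  have lin: "bounded_op X" and adj: "adjoint_pair X X" and nn: "\<And>x. 0 \<le> inner x (X x)"
    using X by (simp_all add: positive_op_def)
  have inv: "X x \<in> ?V" if "x \<in> ?V" for x
  proof -
    have "cinner f (X x) = 0" if f: "f \<in> F" for f
    proof -
      obtain c :: real where "X f = c *\<^sub>R f" using F[OF f] by blast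
      hence "cinner f (X x) = c * cinner f x" using adj unfolding adjoint_pair_def by (metis cinner_scaleR_left)
      thus ?thesis using \<open>x \<in> ?V\<close> f by (simp add: orth_compl_def)
    qed
    thus ?thesis by (simp add: orth_compl_def)
  qed
  have sq: "(norm (X x))\<^sup>2 \<le> ?m * inner x (X x)" if "x \<in> ?V" for x
    using norm_le_of_form_le[OF lin adj subspace_orth_compl nn inv form_le_form_sup[OF lin] that] .
  have "\<exists>x. x \<in> ?V \<and> norm x \<le> 1 \<and> ?m - 1 / (real n + 1) < inner x (X x)" for n
  proof -
    have "?m - 1 / (real n + 1) < ?m" by (simp add: add_nonneg_pos)
    hence "\<exists>x\<in>?V \<inter> cball 0 1. ?m - 1 / (real n + 1) < inner x (X x)"
      unfolding form_sup_def using zero_in_orth_compl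
      by (subst (asm) less_cSUP_iff[OF _ form_sup_bdd[OF lin]]) blast+
    thus ?thesis by auto
  qed
  then obtain x where x: "\<And>n. x n \<in> ?V" "\<And>n. norm (x n) \<le> 1"
    "\<And>n. ?m - 1 / (real n + 1) < inner (x n) (X (x n))" by metis
  obtain r :: "nat \<Rightarrow> nat" and y where r: "strict_mono r" "(\<lambda>n. X (x (r n))) \<longlonglongrightarrow> y"
    using compact_image_subsequence[OF cpt x(2)] .
  have small: "(\<lambda>n. 1 / (real n + 1)) \<longlonglongrightarrow> 0"
    using LIMSEQ_inverse_real_of_nat by (simp add: inverse_eq_divide add.commute)
  have "(\<lambda>n. X (x n) - ?m *\<^sub>R x n) \<longlonglongrightarrow> 0"
  proof -
    have le: "(norm (X (x n) - ?m *\<^sub>R x n))\<^sup>2 \<le> ?m * (1 / (real n + 1))" for n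
    proof -
      have "(norm (X (x n) - ?m *\<^sub>R x n))\<^sup>2
          = (norm (X (x n)))\<^sup>2 - 2 * ?m * inner (x n) (X (x n)) + ?m\<^sup>2 * (norm (x n))\<^sup>2"
        unfolding power2_norm_eq_inner
        by (simp add: inner_diff_left inner_diff_right inner_commute power2_eq_square algebra_simps)
      also have "\<dots> \<le> ?m * inner (x n) (X (x n)) - 2 * ?m * inner (x n) (X (x n)) + ?m\<^sup>2 * 1"
        using sq[OF x(1)[of n]] x(2)[of n] pos
        by (intro add_mono diff_mono mult_left_mono) (auto simp: power_le_one)
      also have "\<dots> = ?m * (?m - inner (x n) (X (x n)))" by (simp add: power2_eq_square algebra_simps)
      also have "\<dots> \<le> ?m * (1 / (real n + 1))" using x(3)[of n] pos by (intro mult_left_mono) auto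
      finally show ?thesis .
    qed
    have "(\<lambda>n. (norm (X (x n) - ?m *\<^sub>R x n))\<^sup>2) \<longlonglongrightarrow> 0"
      by (rule tendsto_sandwich[OF _ _ tendsto_const tendsto_mult_right_zero[OF small, of ?m]])
         (use le in auto)
    hence "(\<lambda>n. sqrt ((norm (X (x n) - ?m *\<^sub>R x n))\<^sup>2)) \<longlonglongrightarrow> sqrt 0" by (rule tendsto_real_sqrt)
    thus ?thesis by (simp add: tendsto_norm_zero_iff)
  qed
  from LIMSEQ_subseq_LIMSEQ[OF this r(1)]
  have "(\<lambda>n. X (x (r n)) - ?m *\<^sub>R x (r n)) \<longlonglongrightarrow> 0" by (simp add: o_def)
  from tendsto_diff[OF r(2) this]
  have "(\<lambda>n. ?m *\<^sub>R x (r n)) \<longlonglongrightarrow> y" by simp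
  from tendsto_scaleR[OF tendsto_const[of "1 / ?m"] this]
  have xe: "(\<lambda>n. x (r n)) \<longlonglongrightarrow> (1 / ?m) *\<^sub>R y" using pos by simp
  define e where "e = (1 / ?m) *\<^sub>R y"
  have Xe: "(\<lambda>n. X (x (r n))) \<longlonglongrightarrow> X e"
    using lin xe bounded_linear.tendsto unfolding bounded_op_def e_def by blast
  have ev: "X e = ?m *\<^sub>R e"
    using LIMSEQ_unique[OF Xe r(2)] pos by (simp add: e_def)
  have eV: "e \<in> ?V" using closed_sequentially[OF closed_orth_compl _ xe] x(1) by (simp add: e_def)
  have "(\<lambda>n. inner (x (r n)) (X (x (r n)))) \<longlonglongrightarrow> inner e (X e)"
    using xe Xe unfolding e_def by (intro tendsto_intros)
  moreover have "(\<lambda>n. ?m - 1 / (real (r n) + 1)) \<longlonglongrightarrow> ?m - 0"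
    using LIMSEQ_subseq_LIMSEQ[OF small r(1)] by (intro tendsto_intros) (simp add: o_def)
  ultimately have "?m - 0 \<le> inner e (X e)"
    using x(3) by (intro LIMSEQ_le) (auto intro!: less_imp_le)
  hence "?m * 1 \<le> ?m * (norm e)\<^sup>2" by (simp add: ev dot_square_norm)
  hence "1 \<le> (norm e)\<^sup>2" using pos by simp
  moreover have "norm e \<le> 1"
    using LIMSEQ_le_const2[OF tendsto_norm[OF xe], of 1] x(2) by (auto simp: e_def)
  ultimately have "norm e = 1" using abs_square_less_1[of "norm e"] by simp
  thus thesis using that eV ev by blast
qed

text \<open>The data of the spectral theorem in the form in which the singular values need it: eigenvalues in
  decreasing order, orthogonal eigenvectors, and the extremal property of the \<open>n\<close>-th eigenvalue. The
  eigenvectors are unit vectors only for positive eigenvalues, since in finite dimension the sequence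
  has to be continued by zeros.\<close>

definition eigen_sequence ::
    "('a::complex_inner \<Rightarrow> 'a) \<Rightarrow> (nat \<Rightarrow> real) \<Rightarrow> (nat \<Rightarrow> 'a) \<Rightarrow> bool" where
  "eigen_sequence X s e \<longleftrightarrow>
     decseq s \<and> (\<forall>n. 0 \<le> s n) \<and> s \<longlonglongrightarrow> 0 \<and> (\<forall>n. X (e n) = s n *\<^sub>R e n) \<and>
     (\<forall>m n. m \<noteq> n \<longrightarrow> cinner (e m) (e n) = 0) \<and> (\<forall>n. 0 < s n \<longrightarrow> norm (e n) = 1) \<and>
     (\<forall>n x. (\<forall>k<n. cinner (e k) x = 0) \<longrightarrow> inner x (X x) \<le> s n * (norm x)\<^sup>2)"

definition next_eigenvector :: "('a::complex_inner \<Rightarrow> 'a) \<Rightarrow> 'a set \<Rightarrow> 'a" where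
  "next_eigenvector X F =
     (if form_sup X F > 0
      then (SOME e. e \<in> orth_compl F \<and> norm e = 1 \<and> X e = form_sup X F *\<^sub>R e) else 0)"

fun eigenvector_set :: "('a::complex_inner \<Rightarrow> 'a) \<Rightarrow> nat \<Rightarrow> 'a set" where
  "eigenvector_set X 0 = {}"
| "eigenvector_set X (Suc n) =
     insert (next_eigenvector X (eigenvector_set X n)) (eigenvector_set X n)"

text \<open>Eigenvectors are chosen one after the other, each maximising the form on the orthogonal complement of
  its predecessors. If the eigenvalues stayed above some \<open>d > 0\<close>, the images \<open>X e\<^sub>n\<close> of the orthonormal
  eigenvectors would be at mutual distance at least \<open>d\<close>, against compactness.\<close>

lemma eigen_sequence_exists:
  fixes X :: "'a::complex_hilbert \<Rightarrow> 'a"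
  assumes X: "positive_op X" and cpt: "compact (closure (X ` cball 0 1))"
  obtains s e where "eigen_sequence X s e"
proof -
  let ?F = "eigenvector_set X"
  define s where "s = (\<lambda>n. form_sup X (?F n))"
  define e where "e = (\<lambda>n. next_eigenvector X (?F n))"
  have lin: "bounded_op X" using X by (simp add: positive_op_def)
  have F: "?F n = e ` {..<n}" for n by (induction n) (auto simp: e_def lessThan_Suc)
  have step: "e n \<in> orth_compl (?F n) \<and> (s n > 0 \<longrightarrow> norm (e n) = 1) \<and> X (e n) = s n *\<^sub>R e n"
    if "\<And>f. f \<in> ?F n \<Longrightarrow> \<exists>c::real. X f = c *\<^sub>R f" for n
  proof (cases "s n > 0")
    case True
    hence "\<exists>v. v \<in> orth_compl (?F n) \<and> norm v = 1 \<and> X v = s n *\<^sub>R v"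
      using form_sup_eigenvector[OF X cpt that] unfolding s_def by metis
    from someI_ex[OF this] show ?thesis
      using True unfolding e_def s_def next_eigenvector_def by simp
  next
    case False
    thus ?thesis using bounded_op_linear(3)[OF lin] zero_in_orth_compl
      by (auto simp: e_def s_def next_eigenvector_def)
  qed
  have "\<forall>f\<in>?F n. \<exists>c::real. X f = c *\<^sub>R f" for n
  proof (induction n)
    case (Suc n)
    have "X (e n) = s n *\<^sub>R e n" using step[of n] Suc by blast
    thus ?case using Suc by (auto simp: e_def)
  qed simp
  hence e: "e n \<in> orth_compl (?F n)" "s n > 0 \<Longrightarrow> norm (e n) = 1" "X (e n) = s n *\<^sub>R e n" for n
    using step[of n] by blast+
  have dec: "decseq s"
    unfolding s_def by (intro decseq_SucI form_sup_antimono lin) auto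
  have nn: "0 \<le> s n" for n unfolding s_def by (rule form_sup_nonneg[OF lin])
  have orth: "cinner (e m) (e n) = 0" if "m \<noteq> n" for m n
  proof -
    have less: "cinner (e m) (e n) = 0" if "m < n" for m n
      using e(1)[of n] that by (auto simp: F orth_compl_def)
    show ?thesis using less[of m n] less[of n m] that cinner_commute[of "e m" "e n"]
      by (cases "m < n") auto
  qed
  have form: "inner x (X x) \<le> s n * (norm x)\<^sup>2" if "\<forall>k<n. cinner (e k) x = 0" for n x
    unfolding s_def using that by (intro form_le_form_sup lin) (auto simp: F orth_compl_def)
  have "s \<longlonglongrightarrow> 0"
  proof (rule ccontr)
    assume not0: "\<not> s \<longlonglongrightarrow> 0"
    obtain d where d: "s \<longlonglongrightarrow> d" "\<And>n. d \<le> s n"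
      using decseq_convergent[OF dec, of 0] nn by metis
    have "d \<ge> 0" using LIMSEQ_le_const[OF d(1)] nn by blast
    moreover have "d \<noteq> 0" using d(1) not0 by blast
    ultimately have d0: "d > 0" by simp
    have ne: "norm (e n) = 1" for n using e(2) d0 d(2)[of n] by simp
    obtain r :: "nat \<Rightarrow> nat" and l where r: "strict_mono r" "(\<lambda>n. X (e (r n))) \<longlonglongrightarrow> l"
      using compact_image_subsequence[OF cpt, of e] ne by auto
    obtain N where N: "\<And>m n. m \<ge> N \<Longrightarrow> n \<ge> N \<Longrightarrow> dist (X (e (r m))) (X (e (r n))) < d"
      using metric_CauchyD[OF LIMSEQ_imp_Cauchy[OF r(2)] d0] by auto
    let ?a = "r N" and ?b = "r (Suc N)"
    have "?a \<noteq> ?b" using r(1) by (metis n_not_Suc_n strict_mono_eq)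
    hence in0: "inner (e ?a) (e ?b) = 0" by (simp add: Re_cinner[symmetric] orth)
    have "(norm (X (e ?a) - X (e ?b)))\<^sup>2 = (s ?a)\<^sup>2 + (s ?b)\<^sup>2"
    proof -
      have "(norm (a *\<^sub>R u - b *\<^sub>R v))\<^sup>2 = a\<^sup>2 * inner u u - 2 * a * b * inner u v + b\<^sup>2 * inner v v"
        for a b :: real and u v :: 'a
        unfolding power2_norm_eq_inner
        by (simp add: inner_diff_left inner_diff_right inner_commute power2_eq_square algebra_simps)
      thus ?thesis using in0 ne by (simp add: e(3) dot_square_norm)
    qed
    moreover have "d\<^sup>2 \<le> (s ?a)\<^sup>2" using d(2)[of ?a] d0 by (simp add: power_mono)
    ultimately have "d\<^sup>2 \<le> (norm (X (e ?a) - X (e ?b)))\<^sup>2"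
      using zero_le_power2[of "s ?b"] by linarith
    hence "d \<le> dist (X (e ?a)) (X (e ?b))" unfolding dist_norm by (rule power2_le_imp_le) simp
    thus False using N[of N "Suc N"] by simp
  qed
  hence "eigen_sequence X s e"
    unfolding eigen_sequence_def using dec nn e orth form by blast
  thus thesis by (rule that)
qed

lemma orthogonal_independent:
  fixes e :: "'b \<Rightarrow> 'a::complex_inner"
  assumes "\<And>i j. i \<in> J \<Longrightarrow> j \<in> J \<Longrightarrow> i \<noteq> j \<Longrightarrow> cinner (e i) (e j) = 0" "\<And>i. i \<in> J \<Longrightarrow> e i \<noteq> 0"
  shows "inj_on e J" "complex_vector.independent (e ` J)"
proof -
  show "inj_on e J" using assms by (metis inj_onI cinner_self_eq_0)
  show "complex_vector.independent (e ` J)"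
  proof
    assume "complex_vector.dependent (e ` J)"
    then obtain i where i: "i \<in> J" "e i \<in> complex_vector.span (e ` J - {e i})"
      unfolding complex_vector.dependent_def by blast
    have "e ` J - {e i} \<subseteq> orth_compl {e i}" using assms(1) i(1) by (auto simp: orth_compl_def)
    hence "complex_vector.span (e ` J - {e i}) \<subseteq> orth_compl {e i}"
      by (intro complex_vector.span_minimal subspace_orth_compl)
    hence "e i = 0" using i(2) orth_compl_Int[of "e i" "{e i}"] by blast
    thus False using assms(2) i(1) by blast
  qed
qed

lemma complex_dimension_span_independent:
  assumes "finite B" "complex_vector.independent B"
  shows "complex_dimension (complex_vector.span B) = enat (card B)"
  using assms by (auto simp: complex_dimension_def complex_vector.dim_eq_card_independent)

text \<open>An eigenvector for \<open>\<sigma>\<close> that is orthogonal to all \<open>e\<^sub>n\<close> satisfies \<open>\<sigma> \<parallel>z\<parallel>\<^sup>2 \<le> s\<^sub>n \<parallel>z\<parallel>\<^sup>2\<close> for every \<open>n\<close>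
  and hence vanishes; so the \<open>e\<^sub>n\<close> with \<open>s\<^sub>n = \<sigma>\<close> span the eigenspace.\<close>

lemma eigen_sequence_multiplicity:
  fixes X :: "'a::complex_hilbert \<Rightarrow> 'a"
  assumes X: "positive_op X" and s: "eigen_sequence X s e" and \<sigma>: "\<sigma> > 0"
  shows "finite {n. s n = \<sigma>}" "complex_dimension {x. X x = \<sigma> *\<^sub>R x} = enat (card {n. s n = \<sigma>})"
proof -
  let ?J = "{n. s n = \<sigma>}"
  have lin: "bounded_op X" and adj: "adjoint_pair X X" using X by (simp_all add: positive_op_def)
  have s0: "s \<longlonglongrightarrow> 0" and ev: "\<And>n. X (e n) = s n *\<^sub>R e n"
    and orth: "\<And>m n. m \<noteq> n \<Longrightarrow> cinner (e m) (e n) = 0" and nrm: "\<And>n. 0 < s n \<Longrightarrow> norm (e n) = 1"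
    and form: "\<And>n x. (\<And>k. k < n \<Longrightarrow> cinner (e k) x = 0) \<Longrightarrow> inner x (X x) \<le> s n * (norm x)\<^sup>2"
    using s unfolding eigen_sequence_def by blast+
  obtain N where N: "\<And>n. n \<ge> N \<Longrightarrow> s n < \<sigma>"
    using order_tendstoD(2)[OF s0 \<sigma>] unfolding eventually_sequentially by blast
  have "?J \<subseteq> {..<N}" using N by (force simp: not_less[symmetric])
  thus fin: "finite ?J" by (rule finite_subset) simp
  have nrmJ: "norm (e n) = 1" if "n \<in> ?J" for n using that nrm \<sigma> by simp
  have ind: "inj_on e ?J" "complex_vector.independent (e ` ?J)"
    using orthogonal_independent[of ?J e] orth nrmJ by force+
  have sub: "complex_vector.subspace {x. X x = \<sigma> *\<^sub>R x}"
    by (auto simp: complex_vector.subspace_def bounded_op_linear[OF lin] scaleC_add_right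
        scaleR_eq_scaleC scaleC_scaleC mult.commute)
  have "complex_vector.span (e ` ?J) \<subseteq> {x. X x = \<sigma> *\<^sub>R x}"
    using ev by (intro complex_vector.span_minimal sub) auto
  moreover have "{x. X x = \<sigma> *\<^sub>R x} \<subseteq> complex_vector.span (e ` ?J)"
  proof
    fix x assume "x \<in> {x. X x = \<sigma> *\<^sub>R x}"
    hence x: "X x = \<sigma> *\<^sub>R x" by simp
    define w where "w = (\<Sum>j\<in>?J. cinner (e j) x *\<^sub>C e j)"
    have w: "w \<in> complex_vector.span (e ` ?J)"
      unfolding w_def by (intro complex_vector.span_sum complex_vector.span_scale
          complex_vector.span_base) auto
    define z where "z = x - w"
    have "X w = \<sigma> *\<^sub>R w" using w \<open>complex_vector.span (e ` ?J) \<subseteq> _\<close> by blast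
    hence z: "X z = \<sigma> *\<^sub>R z" using x by (simp add: z_def bounded_op_linear[OF lin] scaleR_diff_right)
    have ze: "cinner (e k) z = 0" for k
    proof (cases "s k = \<sigma>")
      case True
      have "cinner (e k) w = (\<Sum>j\<in>?J. cinner (e j) x * cinner (e k) (e j))"
        unfolding w_def by (induction rule: infinite_finite_induct)
          (auto simp: cinner_algebra)
      also have "\<dots> = (\<Sum>j\<in>?J. if j = k then cinner (e k) x else 0)"
        using nrmJ orth by (intro sum.cong) (auto simp: cinner_self)
      also have "\<dots> = cinner (e k) x" using True fin by simp
      finally show ?thesis by (simp add: z_def cinner_algebra)
    next
      case False
      have "cinner (X (e k)) z = cinner (e k) (X z)" using adj by (simp add: adjoint_pair_def)
      hence "complex_of_real (s k) * cinner (e k) z = complex_of_real \<sigma> * cinner (e k) z"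
        by (simp add: ev z)
      thus ?thesis using False by simp
    qed
    have "\<sigma> * (norm z)\<^sup>2 \<le> s N * (norm z)\<^sup>2"
      using form[of N z] ze by (simp add: z dot_square_norm)
    hence "z = 0" using N[of N] by (simp add: mult_le_cancel_right)
    thus "x \<in> complex_vector.span (e ` ?J)" using w by (simp add: z_def)
  qed
  ultimately have "{x. X x = \<sigma> *\<^sub>R x} = complex_vector.span (e ` ?J)" by blast
  thus "complex_dimension {x. X x = \<sigma> *\<^sub>R x} = enat (card ?J)"
    using complex_dimension_span_independent[OF _ ind(2)] fin card_image[OF ind(1)] by simp
qed


section \<open>Singular values\<close>

lemma gram_kernel:
  assumes "adjoint_pair T T'"
  shows "op_ker (op_shift (op_adjoint UNIV (op_of T) \<circ>\<^sub>o op_of T) (- of_real c))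
    = {x. T' (T x) = c *\<^sub>R x}"
  by (simp add: op_adjoint_op_of[OF assms] op_ker_def scaleR_eq_scaleC eq_commute
      complex_vector.scale_minus_left)

lemma singular_values_op_of:
  assumes "adjoint_pair T T'"
  shows "singular_values UNIV (op_of T) s \<longleftrightarrow>
    decseq s \<and> (\<forall>n. 0 \<le> s n) \<and>
    (\<forall>\<sigma>>0. finite {n. s n = \<sigma>} \<and>
       complex_dimension {x. T' (T x) = \<sigma>\<^sup>2 *\<^sub>R x} = enat (card {n. s n = \<sigma>}))"
  unfolding singular_values_def gram_kernel[OF assms] by (rule refl)

text \<open>Otherwise \<open>X x - \<sigma> x\<close> would be an eigenvector of \<open>X\<close> for the negative number \<open>-\<sigma>\<close>.\<close>

lemma positive_op_square_eigenspace:
  assumes X: "positive_op X" and "\<sigma> > 0"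
  shows "X (X x) = \<sigma>\<^sup>2 *\<^sub>R x \<longleftrightarrow> X x = \<sigma> *\<^sub>R x"
proof
  have lin: "bounded_op X" using X by (simp add: positive_op_def)
  note s = bounded_op_linear[OF lin]
  show "X (X x) = \<sigma>\<^sup>2 *\<^sub>R x" if "X x = \<sigma> *\<^sub>R x" using that by (simp add: s power2_eq_square)
  assume sq: "X (X x) = \<sigma>\<^sup>2 *\<^sub>R x"
  define y where "y = X x - \<sigma> *\<^sub>R x"
  have "X y = - \<sigma> *\<^sub>R y" by (simp add: y_def s sq power2_eq_square algebra_simps)
  hence "inner y (X y) = - \<sigma> * (norm y)\<^sup>2" by (simp add: dot_square_norm)
  moreover have "0 \<le> inner y (X y)" using X by (simp add: positive_op_def)
  ultimately have "\<sigma> * (norm y)\<^sup>2 \<le> 0" by simp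
  hence "y = 0" using \<open>\<sigma> > 0\<close> by (simp add: mult_le_0_iff)
  thus "X x = \<sigma> *\<^sub>R x" by (simp add: y_def)
qed

lemma singular_values_positive_op:
  assumes X: "positive_op X"
  shows "singular_values UNIV (op_of X) s \<longleftrightarrow>
    decseq s \<and> (\<forall>n. 0 \<le> s n) \<and>
    (\<forall>\<sigma>>0. finite {n. s n = \<sigma>} \<and>
       complex_dimension {x. X x = \<sigma> *\<^sub>R x} = enat (card {n. s n = \<sigma>}))"
proof -
  have "adjoint_pair X X" using X by (simp add: positive_op_def)
  thus ?thesis
    unfolding singular_values_op_of[OF \<open>adjoint_pair X X\<close>]
    using positive_op_square_eigenspace[OF X] by simp
qed

lemma eigen_sequence_singular_values:
  fixes X :: "'a::complex_hilbert \<Rightarrow> 'a"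
  assumes "positive_op X" "eigen_sequence X s e"
  shows "singular_values UNIV (op_of X) s"
  using eigen_sequence_multiplicity[OF assms] assms(2)
  unfolding singular_values_positive_op[OF assms(1)] eigen_sequence_def by blast

text \<open>A decreasing sequence is determined by the multiplicities of its positive values: at the first
  index where two such sequences differ, the larger value would be taken more often by one of them.\<close>

lemma decseq_le_by_multiplicity:
  fixes s t :: "nat \<Rightarrow> real"
  assumes "decseq s" "decseq t" "\<And>n. 0 \<le> s n"
    and fin: "\<And>\<sigma>. \<sigma> > 0 \<Longrightarrow> finite {n. t n = \<sigma>}"
    and card: "\<And>\<sigma>. \<sigma> > 0 \<Longrightarrow> card {n. s n = \<sigma>} = card {n. t n = \<sigma>}"
    and eq: "\<And>k. k < n \<Longrightarrow> s k = t k"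
  shows "t n \<le> s n"
proof (rule ccontr)
  assume "\<not> t n \<le> s n"
  hence less: "s n < t n" by simp
  hence pos: "t n > 0" using assms(3)[of n] by simp
  have "{k. s k = t n} \<subset> {k. t k = t n}"
  proof
    show "{k. s k = t n} \<subseteq> {k. t k = t n}"
    proof
      fix k assume "k \<in> {k. s k = t n}"
      hence k: "s k = t n" by simp
      have "k < n"
      proof (rule ccontr)
        assume "\<not> k < n"
        hence "s k \<le> s n" using decseqD[OF assms(1), of n k] by simp
        thus False using k less by simp
      qed
      thus "k \<in> {k. t k = t n}" using eq[of k] k by simp
    qed
    have "n \<in> {k. t k = t n}" "n \<notin> {k. s k = t n}" using less by auto
    thus "{k. s k = t n} \<noteq> {k. t k = t n}" by blast
  qed
  hence "card {k. s k = t n} < card {k. t k = t n}" by (rule psubset_card_mono[OF fin[OF pos]])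
  thus False using card[OF pos] by simp
qed

lemma singular_values_unique:
  assumes s: "singular_values M T s" and t: "singular_values M T t"
  shows "s = t"
proof
  have dec: "decseq s" "decseq t" and nn: "\<And>n. 0 \<le> s n" "\<And>n. 0 \<le> t n"
    and fin: "\<And>\<sigma>. \<sigma> > 0 \<Longrightarrow> finite {n. s n = \<sigma>}" "\<And>\<sigma>. \<sigma> > 0 \<Longrightarrow> finite {n. t n = \<sigma>}"
    using s t by (auto simp: singular_values_def)
  have card: "card {n. s n = \<sigma>} = card {n. t n = \<sigma>}" if "\<sigma> > 0" for \<sigma>
  proof -
    let ?d = "complex_dimension (op_ker (op_shift (op_adjoint M T \<circ>\<^sub>o T) (- of_real (\<sigma>\<^sup>2))))"
    have "?d = enat (card {n. s n = \<sigma>})" "?d = enat (card {n. t n = \<sigma>})"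
      using s[unfolded singular_values_def] t[unfolded singular_values_def] that by blast+
    thus ?thesis by simp
  qed
  show "s n = t n" for n
  proof (induction n rule: less_induct)
    case (less n)
    have "t n \<le> s n" using decseq_le_by_multiplicity[OF dec nn(1) fin(2) card less] .
    moreover have "s n \<le> t n"
      using decseq_le_by_multiplicity[OF dec(2,1) nn(2) fin(1) card[symmetric] less[symmetric]] .
    ultimately show ?case by simp
  qed
qed

text \<open>The eigenvalue \<open>\<sigma>\<^sup>2\<close> of \<open>T\<^sup>*T\<close> records the singular value \<open>\<sigma>\<close> of \<open>T\<close> and, as \<open>T\<^sup>*T\<close> is positive, the
  singular value \<open>\<sigma>\<^sup>2\<close> of \<open>T\<^sup>*T\<close>.\<close>

lemma singular_values_gram_iff:
  assumes T: "bounded_op T" "bounded_op T'" "adjoint_pair T T'" and nn: "\<And>n. 0 \<le> s n"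
  shows "singular_values UNIV (op_of (T' \<circ> T)) (\<lambda>n. (s n)\<^sup>2) \<longleftrightarrow> singular_values UNIV (op_of T) s"
proof -
  have adj: "adjoint_pair (T' \<circ> T) (T' \<circ> T)"
    using adjoint_pair_compose[OF adjoint_pair_sym[OF T(3)] T(3)] .
  have "0 \<le> inner x (T' (T x))" for x
    using adjoint_pair_inner[OF T(3), of x "T x"] by (metis inner_ge_zero)
  hence pos: "positive_op (T' \<circ> T)" using bounded_op_compose[OF T(2,1)] adj by (simp add: positive_op_def)
  have sq: "{n. (s n)\<^sup>2 = \<sigma>\<^sup>2} = {n. s n = \<sigma>}" if "\<sigma> > 0" for \<sigma>
    using nn that by (auto simp: power2_eq_iff_nonneg)
  have ex: "(\<forall>\<sigma>>0. P \<sigma>) \<longleftrightarrow> (\<forall>\<sigma>>0. P (\<sigma>\<^sup>2))" for P :: "real \<Rightarrow> bool"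
  proof
    assume *: "\<forall>\<sigma>>0. P (\<sigma>\<^sup>2)"
    show "\<forall>\<sigma>>0. P \<sigma>"
    proof (intro allI impI)
      fix \<sigma> :: real assume "\<sigma> > 0"
      hence "sqrt \<sigma> > 0" "(sqrt \<sigma>)\<^sup>2 = \<sigma>" by simp_all
      thus "P \<sigma>" using * by metis
    qed
  qed simp
  have "decseq (\<lambda>n. (s n)\<^sup>2) \<longleftrightarrow> decseq s" using nn by (simp add: decseq_def)
  thus ?thesis
    unfolding singular_values_positive_op[OF pos] singular_values_op_of[OF T(3)]
    by (subst ex) (simp add: sq nn cong: imp_cong)
qed

lemma complex_dimension_image_le:
  assumes f: "bounded_op f"
  shows "complex_dimension (f ` V) \<le> complex_dimension V"
proof (cases "\<exists>B. finite B \<and> V \<subseteq> complex_vector.span B")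
  case True
  then obtain B0 where B0: "finite B0" "V \<subseteq> complex_vector.span B0" by blast
  interpret f: Vector_Spaces.linear "scaleC :: complex \<Rightarrow> 'a \<Rightarrow> 'a" "scaleC :: complex \<Rightarrow> 'a \<Rightarrow> 'a" f
    by unfold_locales (simp_all add: bounded_op_linear[OF f])
  obtain B where B: "B \<subseteq> V" "complex_vector.independent B" "V \<subseteq> complex_vector.span B"
    "card B = complex_vector.dim V"
    using complex_vector.basis_exists .
  have fin: "finite B"
    using complex_vector.independent_span_bound[OF B0(1) B(2)] B(1) B0(2) by blast
  have sub: "f ` V \<subseteq> complex_vector.span (f ` B)" using B(3) by (auto simp: f.span_image)
  have "complex_vector.dim (f ` V) \<le> card (f ` B)"
    using complex_vector.dim_le_card[OF sub] fin by blast
  also have "\<dots> \<le> card B" using fin by (rule card_image_le)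
  finally have "enat (complex_vector.dim (f ` V)) \<le> enat (complex_vector.dim V)" using B(4) by simp
  moreover have "\<exists>B. finite B \<and> f ` V \<subseteq> complex_vector.span B" using sub fin by blast
  ultimately show ?thesis using True by (simp add: complex_dimension_def)
next
  case False
  hence "complex_dimension V = \<infinity>" unfolding complex_dimension_def by (rule if_not_P)
  thus ?thesis by simp
qed

text \<open>\<open>T\<close> maps the eigenspace of \<open>T\<^sup>*T\<close> for a nonzero eigenvalue onto that of \<open>T T\<^sup>*\<close>.\<close>

lemma gram_eigenspace_dimension_le:
  assumes T: "bounded_op T" "bounded_op T'" and "c \<noteq> 0"
  shows "complex_dimension {x. T (T' x) = c *\<^sub>R x} \<le> complex_dimension {x. T' (T x) = c *\<^sub>R x}"
proof -
  note s = bounded_op_linear[OF T(1)] bounded_op_linear[OF T(2)]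
  have "{x. T (T' x) = c *\<^sub>R x} = T ` {x. T' (T x) = c *\<^sub>R x}"
  proof
    show "{x. T (T' x) = c *\<^sub>R x} \<subseteq> T ` {x. T' (T x) = c *\<^sub>R x}"
    proof
      fix y assume "y \<in> {x. T (T' x) = c *\<^sub>R x}"
      hence y: "T (T' y) = c *\<^sub>R y" by simp
      have "T ((1 / c) *\<^sub>R T' y) = y" using y \<open>c \<noteq> 0\<close> by (simp add: s)
      moreover have "T' (T ((1 / c) *\<^sub>R T' y)) = c *\<^sub>R (1 / c) *\<^sub>R T' y" using y \<open>c \<noteq> 0\<close> by (simp add: s)
      ultimately show "y \<in> T ` {x. T' (T x) = c *\<^sub>R x}" by (metis (mono_tags) imageI mem_Collect_eq)
    qed
  qed (auto simp: s)
  thus ?thesis using complex_dimension_image_le[OF T(1)] by simp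
qed

lemma singular_values_adjoint_iff:
  assumes T: "bounded_op T" "bounded_op T'" "adjoint_pair T T'"
  shows "singular_values UNIV (op_of T) s \<longleftrightarrow> singular_values UNIV (op_of T') s"
proof -
  have "complex_dimension {x. T' (T x) = \<sigma>\<^sup>2 *\<^sub>R x} = complex_dimension {x. T (T' x) = \<sigma>\<^sup>2 *\<^sub>R x}"
    if "\<sigma> > 0" for \<sigma>
    using that by (intro antisym gram_eigenspace_dimension_le T) simp_all
  thus ?thesis
    unfolding singular_values_op_of[OF T(3)] singular_values_op_of[OF adjoint_pair_sym[OF T(3)]]
    by simp
qed

text \<open>A vector annihilated by \<open>n\<close> functionals exists in every span of more than \<open>n\<close> independent
  vectors, since the functionals are read off from a linear map of rank at most \<open>n\<close>.\<close>

lemma exists_orthogonal_in_span: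
  fixes f :: "nat \<Rightarrow> 'a::complex_inner"
  assumes B: "complex_vector.independent B" "finite B" "card B > n"
  obtains x where "x \<in> complex_vector.span B" "x \<noteq> 0" "\<And>k. k < n \<Longrightarrow> cinner (f k) x = 0"
proof -
  define L where "L = (\<lambda>x. \<Sum>k<n. cinner (f k) x *\<^sub>C f k)"
  interpret L: Vector_Spaces.linear "scaleC :: complex \<Rightarrow> 'a \<Rightarrow> 'a" "scaleC :: complex \<Rightarrow> 'a \<Rightarrow> 'a" L
    by unfold_locales
       (simp_all add: L_def cinner_algebra complex_vector.scale_left_distrib sum.distrib
        complex_vector.scale_sum_right scaleC_scaleC)
  have "\<not> inj_on L (complex_vector.span B)"
  proof
    assume inj: "inj_on L (complex_vector.span B)"
    have ind: "complex_vector.independent (L ` B)" using L.independent_injective_image[OF B(1) inj] .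
    have "L x \<in> complex_vector.span (f ` {..<n})" for x
      unfolding L_def by (intro complex_vector.span_sum complex_vector.span_scale
          complex_vector.span_base) auto
    hence "card (L ` B) \<le> card (f ` {..<n})"
      using complex_vector.independent_span_bound[OF _ ind, of "f ` {..<n}"] by blast
    also have "\<dots> \<le> n" using card_image_le[of "{..<n}" f] by simp
    finally have "card B \<le> n"
      using card_image[OF inj_on_subset[OF inj complex_vector.span_superset]] by simp
    thus False using B(3) by simp
  qed
  then obtain x where x: "x \<in> complex_vector.span B" "x \<noteq> 0" "L x = 0"
    unfolding L.inj_on_iff_eq_0[OF complex_vector.subspace_span] by blast
  have "cinner x (L x) = (\<Sum>k<n. cinner (f k) x * cinner x (f k))"
    unfolding L_def by (induction n) (simp_all add: cinner_algebra)
  also have "\<dots> = (\<Sum>k<n. of_real ((cmod (cinner (f k) x))\<^sup>2))"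
  proof (rule sum.cong[OF refl])
    fix k
    have "cinner x (f k) = cnj (cinner (f k) x)" by (rule cinner_commute)
    thus "cinner (f k) x * cinner x (f k) = of_real ((cmod (cinner (f k) x))\<^sup>2)"
      by (simp only: complex_norm_square)
  qed
  finally have "(\<Sum>k<n. of_real ((cmod (cinner (f k) x))\<^sup>2)) = (0::complex)" using x(3) by simp
  hence "(\<Sum>k<n. (cmod (cinner (f k) x))\<^sup>2) = 0"
    unfolding of_real_sum[symmetric] of_real_eq_0_iff .
  hence "cinner (f k) x = 0" if "k < n" for k
    using that by (subst (asm) sum_nonneg_eq_0_iff) auto
  thus thesis using that x(1,2) by blast
qed

text \<open>Min-max comparison: the span of the first \<open>n + 1\<close> eigenvectors of the compression \<open>P A P\<close> lies in
  the range of \<open>P\<close>, and contains a nonzero vector orthogonal to the first \<open>n\<close> eigenvectors of \<open>A\<close>. At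
  that vector the forms of \<open>A\<close> and \<open>P A P\<close> agree.\<close>

lemma eigen_sequence_compression_le:
  fixes A :: "'a::complex_hilbert \<Rightarrow> 'a"
  assumes A: "eigen_sequence A a f" and proj: "projection_op P"
    and X: "X = P \<circ> A \<circ> P" "positive_op X" "eigen_sequence X s e"
  shows "s n \<le> a n"
proof (cases "s n > 0")
  case False
  thus ?thesis using A by (auto simp: eigen_sequence_def not_less intro: order_trans)
next
  case True
  have P: "bounded_op P" "adjoint_pair P P" "\<And>x. P (P x) = P x"
    using proj by (simp_all add: projection_op_def)
  have dec: "decseq s" and ev: "\<And>n. X (e n) = s n *\<^sub>R e n"
    and orth: "\<And>m n. m \<noteq> n \<Longrightarrow> cinner (e m) (e n) = 0" and nrm: "\<And>n. 0 < s n \<Longrightarrow> norm (e n) = 1"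
    using X(3) unfolding eigen_sequence_def by blast+
  have form: "\<And>x. (\<And>k. k < n \<Longrightarrow> cinner (f k) x = 0) \<Longrightarrow> inner x (A x) \<le> a n * (norm x)\<^sup>2"
    using A unfolding eigen_sequence_def by blast
  have lin: "bounded_op X" using X(2) by (simp add: positive_op_def)
  have sn: "s n \<le> s k" "s k > 0" if "k \<le> n" for k
    using decseqD[OF dec that] True by simp_all
  have e1: "norm (e k) = 1" if "k \<in> {..n}" for k using that nrm sn by simp
  have ind: "inj_on e {..n}" "complex_vector.independent (e ` {..n})"
    using orthogonal_independent[of "{..n}" e] orth e1 by force+
  have "card (e ` {..n}) > n" using card_image[OF ind(1)] by simp
  then obtain x where x: "x \<in> complex_vector.span (e ` {..n})" "x \<noteq> 0"
      "\<And>k. k < n \<Longrightarrow> cinner (f k) x = 0"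
    using exists_orthogonal_in_span[OF ind(2)] by blast
  define c where "c = (\<lambda>k. cinner (e k) x)"
  have xsum: "x = (\<Sum>k\<le>n. c k *\<^sub>C e k)"
  proof -
    let ?w = "\<Sum>k\<le>n. c k *\<^sub>C e k"
    have "?w \<in> complex_vector.span (e ` {..n})"
      by (intro complex_vector.span_sum complex_vector.span_scale complex_vector.span_base) auto
    hence d: "x - ?w \<in> complex_vector.span (e ` {..n})" using x(1) by (intro complex_vector.span_diff)
    have "cinner (e j) (x - ?w) = 0" if "j \<le> n" for j
    proof -
      have "cinner (e j) ?w = (\<Sum>k\<le>n. c k * cinner (e j) (e k))"
        by (induction n) (simp_all add: cinner_algebra)
      also have "\<dots> = (\<Sum>k\<le>n. if k = j then c j else 0)"
        using orth e1 that by (intro sum.cong) (auto simp: cinner_self)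
      also have "\<dots> = c j" using that by simp
      finally show ?thesis by (simp add: cinner_algebra c_def)
    qed
    hence "e ` {..n} \<subseteq> orth_compl {x - ?w}"
      using cinner_commute[of "x - ?w"] by (auto simp: orth_compl_def)
    hence "complex_vector.span (e ` {..n}) \<subseteq> orth_compl {x - ?w}"
      by (intro complex_vector.span_minimal subspace_orth_compl)
    hence "x - ?w \<in> orth_compl {x - ?w}" using d by blast
    hence "x - ?w = 0" using orth_compl_Int[of "x - ?w" "{x - ?w}"] by blast
    thus ?thesis by simp
  qed
  have lb: "s n * (norm x)\<^sup>2 \<le> inner x (X x)"
  proof -
    have xy: "cinner x y = (\<Sum>k\<le>n. cnj (c k) * cinner (e k) y)" for y
      by (subst xsum) (induction n, simp_all add: cinner_algebra)
    have "cinner x x = (\<Sum>k\<le>n. of_real ((cmod (c k))\<^sup>2))"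
      unfolding xy
      by (intro sum.cong refl) (simp only: complex_norm_square mult.commute c_def)
    hence "Re (cinner x x) = Re (of_real (\<Sum>k\<le>n. (cmod (c k))\<^sup>2))" by simp
    hence nx: "(norm x)\<^sup>2 = (\<Sum>k\<le>n. (cmod (c k))\<^sup>2)" by (simp add: Re_cinner dot_square_norm)
    have "cinner (e k) (X x) = s k * c k" for k
      using X(2) ev unfolding positive_op_def adjoint_pair_def c_def
      by (metis cinner_scaleR_left)
    hence "cinner x (X x) = (\<Sum>k\<le>n. of_real (s k) * of_real ((cmod (c k))\<^sup>2))"
      unfolding xy by (intro sum.cong refl) (simp only: complex_norm_square mult_ac)
    hence "Re (cinner x (X x)) = Re (of_real (\<Sum>k\<le>n. s k * (cmod (c k))\<^sup>2))" by simp
    hence "inner x (X x) = (\<Sum>k\<le>n. s k * (cmod (c k))\<^sup>2)" by (simp add: Re_cinner)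
    moreover have "(\<Sum>k\<le>n. s n * (cmod (c k))\<^sup>2) \<le> (\<Sum>k\<le>n. s k * (cmod (c k))\<^sup>2)"
      using sn by (intro sum_mono mult_right_mono) auto
    ultimately show ?thesis unfolding nx by (simp add: sum_distrib_left)
  qed
  have "P (e k) = e k" if "k \<le> n" for k
  proof -
    have "s k *\<^sub>R P (e k) = P (X (e k))" by (simp add: ev bounded_op_linear[OF P(1)])
    also have "\<dots> = X (e k)" by (simp add: X(1) P(3))
    also have "\<dots> = s k *\<^sub>R e k" by (rule ev)
    finally show ?thesis using sn(2)[OF that] by simp
  qed
  hence "e ` {..n} \<subseteq> {x. P x = x}" by auto
  moreover have "complex_vector.subspace {x. P x = x}"
    by (auto simp: complex_vector.subspace_def bounded_op_linear[OF P(1)])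
  ultimately have "P x = x" using complex_vector.span_minimal x(1) by blast
  hence "inner x (X x) = inner x (A x)"
    using adjoint_pair_inner[OF P(2), of x "A x"] by (simp add: X(1))
  hence "s n * (norm x)\<^sup>2 \<le> a n * (norm x)\<^sup>2" using lb form[OF x(3)] by linarith
  thus ?thesis using x(2) by simp
qed


section \<open>Schatten classes\<close>

lemma schatten_class_op_of:
  assumes "bounded_op T"
  shows "op_of T \<in> schatten_class p UNIV \<longleftrightarrow> compact (closure (T ` cball 0 1)) \<and>
    (p \<noteq> \<infinity> \<longrightarrow> (\<exists>s. singular_values UNIV (op_of T) s \<and> summable (\<lambda>n. s n powr real_of_ereal p)))"
  by (simp add: schatten_class_def compact_operator_op_of[OF assms])

lemma schatten_class_gram_iff:
  fixes T T' :: "'a::complex_hilbert \<Rightarrow> 'a"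
  assumes T: "bounded_op T" "bounded_op T'" "adjoint_pair T T'" and p: "p > 0"
  shows "op_of (T' \<circ> T) \<in> schatten_class p UNIV \<longleftrightarrow> op_of T \<in> schatten_class (2 * p) UNIV"
proof -
  have sv: "(\<exists>s. singular_values UNIV (op_of (T' \<circ> T)) s \<and> summable (\<lambda>n. s n powr q)) \<longleftrightarrow>
      (\<exists>s. singular_values UNIV (op_of T) s \<and> summable (\<lambda>n. s n powr (2 * q)))" for q :: real
  proof
    assume "\<exists>s. singular_values UNIV (op_of (T' \<circ> T)) s \<and> summable (\<lambda>n. s n powr q)"
    then obtain s where s: "singular_values UNIV (op_of (T' \<circ> T)) s" "summable (\<lambda>n. s n powr q)" by blast
    have nn: "0 \<le> s n" for n using s(1) by (simp add: singular_values_def)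
    define t where "t = (\<lambda>n. sqrt (s n))"
    have t: "s = (\<lambda>n. (t n)\<^sup>2)" "\<And>n. 0 \<le> t n" using nn by (auto simp: t_def)
    have "t n powr (2 * q) = s n powr q" for n
      using t(2)[of n] by (simp add: t(1) powr_powr[symmetric] powr_realpow' flip: powr_numeral)
    thus "\<exists>s. singular_values UNIV (op_of T) s \<and> summable (\<lambda>n. s n powr (2 * q))"
      using singular_values_gram_iff[where s = t, OF T t(2)] s
      by (intro exI[of _ t]) (simp add: t(1))
  next
    assume "\<exists>s. singular_values UNIV (op_of T) s \<and> summable (\<lambda>n. s n powr (2 * q))"
    then obtain t where t: "singular_values UNIV (op_of T) t" "summable (\<lambda>n. t n powr (2 * q))" by blast
    have nn: "0 \<le> t n" for n using t(1) by (simp add: singular_values_def)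
    have "t n powr (2 * q) = (t n)\<^sup>2 powr q" for n
      using nn[of n] by (simp add: powr_powr[symmetric] flip: powr_numeral)
    thus "\<exists>s. singular_values UNIV (op_of (T' \<circ> T)) s \<and> summable (\<lambda>n. s n powr q)"
      using singular_values_gram_iff[where s = t, OF T nn] t
      by (intro exI[of _ "\<lambda>n. (t n)\<^sup>2"]) simp
  qed
  show ?thesis
    unfolding schatten_class_op_of[OF bounded_op_compose[OF T(2,1)]] schatten_class_op_of[OF T(1)]
      compact_gram_iff[OF T]
    using p sv by (cases p) auto
qed

text \<open>Compactness of \<open>T\<^sup>*\<close> comes from that of \<open>T T\<^sup>*\<close>, which is the Gram operator of \<open>T\<^sup>*\<close>.\<close>

lemma schatten_class_adjoint_imp:
  fixes T T' :: "'a::complex_hilbert \<Rightarrow> 'a"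
  assumes T: "bounded_op T" "bounded_op T'" "adjoint_pair T T'"
    and mem: "op_of T \<in> schatten_class p UNIV"
  shows "op_of T' \<in> schatten_class p UNIV"
proof -
  have "compact (closure (T ` cball 0 1))" using mem schatten_class_op_of[OF T(1)] by blast
  hence "compact (closure ((T \<circ> T') ` cball 0 1))" by (rule compact_compose_right[OF T(1,2)])
  hence "compact (closure (T' ` cball 0 1))"
    using compact_gram_iff[OF T(2,1) adjoint_pair_sym[OF T(3)]] by blast
  thus ?thesis
    using mem singular_values_adjoint_iff[OF T]
    unfolding schatten_class_op_of[OF T(1)] schatten_class_op_of[OF T(2)] by blast
qed

lemma positive_op_compression:
  assumes P: "projection_op P" and A: "positive_op A" shows "positive_op (P \<circ> A \<circ> P)"
proof -
  have "bounded_op (P \<circ> A \<circ> P)"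
    using P A by (intro bounded_op_compose) (auto simp: projection_op_def positive_op_def)
  moreover have "adjoint_pair (P \<circ> A \<circ> P) (P \<circ> A \<circ> P)"
    using P A adjoint_pair_compose[OF adjoint_pair_compose[of P P A A], of P P]
    by (simp add: projection_op_def positive_op_def comp_assoc)
  moreover have "0 \<le> inner x (P (A (P x)))" for x
  proof -
    have "inner x (P (A (P x))) = inner (P x) (A (P x))"
      using P adjoint_pair_inner[of P P x "A (P x)"] by (simp add: projection_op_def)
    thus ?thesis using A by (simp add: positive_op_def)
  qed
  ultimately show ?thesis by (simp add: positive_op_def)
qed

text \<open>No convexity is available for \<open>p < 1\<close>, so the singular values of the compression are compared with
  those of \<open>A\<close> one by one.\<close>

lemma schatten_class_compression:
  fixes A :: "'a::complex_hilbert \<Rightarrow> 'a"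
  assumes P: "projection_op P" and A: "positive_op A" and mem: "op_of A \<in> schatten_class p UNIV"
    and p: "p > 0"
  shows "op_of (P \<circ> A \<circ> P) \<in> schatten_class p UNIV"
proof -
  let ?X = "P \<circ> A \<circ> P"
  have Plin: "bounded_op P" and Alin: "bounded_op A" using P A by (simp_all add: projection_op_def positive_op_def)
  have X: "positive_op ?X" by (rule positive_op_compression[OF P A])
  hence Xlin: "bounded_op ?X" by (simp add: positive_op_def)
  have cA: "compact (closure (A ` cball 0 1))" using mem schatten_class_op_of[OF Alin] by blast
  have cX: "compact (closure (?X ` cball 0 1))"
    using compact_compose_right[OF bounded_op_compose[OF Plin Alin] Plin compact_compose_left[OF Plin cA]] .
  have "\<exists>s. singular_values UNIV (op_of ?X) s \<and> summable (\<lambda>n. s n powr real_of_ereal p)" if "p \<noteq> \<infinity>"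
  proof -
    obtain a' where a': "singular_values UNIV (op_of A) a'" "summable (\<lambda>n. a' n powr real_of_ereal p)"
      using mem \<open>p \<noteq> \<infinity>\<close> schatten_class_op_of[OF Alin] by blast
    obtain a f where a: "eigen_sequence A a f" using eigen_sequence_exists[OF A cA] .
    obtain s e where s: "eigen_sequence ?X s e" using eigen_sequence_exists[OF X cX] .
    have "a' = a" using singular_values_unique[OF a'(1) eigen_sequence_singular_values[OF A a]] .
    have le: "s n \<le> a' n" "0 \<le> s n" for n
      using eigen_sequence_compression_le[OF a P refl X s] s \<open>a' = a\<close>
      by (simp_all add: eigen_sequence_def)
    have "0 \<le> real_of_ereal p" using p by (cases p) auto
    hence "summable (\<lambda>n. s n powr real_of_ereal p)"
      using le by (intro summable_comparison_test'[OF a'(2)]) (auto intro: powr_mono2)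
    thus ?thesis using eigen_sequence_singular_values[OF X s] by blast
  qed
  thus ?thesis using cX schatten_class_op_of[OF Xlin] by blast
qed

text \<open>On the range of \<open>P\<close> the operators \<open>P A\<close> and \<open>P A P\<close> agree, and \<open>P A P\<close> vanishes on its
  orthogonal complement, so both have the same image of the unit ball and the same nonzero singular
  values.\<close>

lemma schatten_class_restrict_iff:
  fixes A :: "'a::complex_hilbert \<Rightarrow> 'a"
  assumes P: "projection_op P" and A: "positive_op A"
  shows "{(y, P (A y)) | y. y \<in> range P} \<in> schatten_class p (range P)
    \<longleftrightarrow> op_of (P \<circ> A \<circ> P) \<in> schatten_class p UNIV"
proof -
  let ?X = "P \<circ> A \<circ> P" and ?M = "range P"
  let ?R = "{(y, P (A y)) | y. y \<in> ?M}"
  have Plin: "bounded_op P" and Alin: "bounded_op A" and PP: "\<And>x. P (P x) = P x"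
    and Padj: "adjoint_pair P P" and Aadj: "adjoint_pair A A"
    using P A by (simp_all add: projection_op_def positive_op_def)
  have X: "positive_op ?X" by (rule positive_op_compression[OF P A])
  hence Xlin: "bounded_op ?X" and Xadj: "adjoint_pair ?X ?X" by (simp_all add: positive_op_def)
  have Pfix: "P x = x" if "x \<in> ?M" for x using that PP by auto
  have mem_R: "(x, y) \<in> ?R \<longleftrightarrow> x \<in> ?M \<and> y = ?X x" for x y
  proof -
    have "(x, y) \<in> ?R \<longleftrightarrow> x \<in> ?M \<and> y = P (A x)" by blast
    moreover have "x \<in> ?M \<Longrightarrow> ?X x = P (A x)" by (simp only: comp_apply Pfix)
    ultimately show ?thesis by argo
  qed
  note s = bounded_op_linear[OF Plin] bounded_op_linear[OF Xlin]
  have M: "complex_vector.subspace ?M"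
  proof -
    have "?M = {x. P x = x}" using Pfix by (metis (mono_tags, lifting) Collect_cong Collect_mem_eq rangeI)
    thus ?thesis by (simp add: complex_vector.subspace_def s)
  qed
  have "linear_operator ?M ?R"
    unfolding linear_operator_def
  proof (intro conjI allI impI)
    show "?R \<subseteq> ?M \<times> ?M" by auto
    show "single_valued ?R" by (auto simp: single_valued_def)
    show "(0, 0) \<in> ?R"
      unfolding mem_R using complex_vector.subspace_0[OF M] s by metis
    show "(x + x', y + y') \<in> ?R" if "(x, y) \<in> ?R" "(x', y') \<in> ?R" for x y x' y'
      using that complex_vector.subspace_add[OF M] unfolding mem_R s by blast
    show "(c *\<^sub>C x, c *\<^sub>C y) \<in> ?R" if "(x, y) \<in> ?R" for c x y
      using that complex_vector.subspace_scale[OF M] unfolding mem_R s by blast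
  qed
  moreover have "Domain ?R = ?M" by auto
  moreover have "?R `` (?M \<inter> cball 0 1) = ?X ` cball 0 1"
  proof
    show "?R `` (?M \<inter> cball 0 1) \<subseteq> ?X ` cball 0 1" unfolding Image_def mem_R by auto
    show "?X ` cball 0 1 \<subseteq> ?R `` (?M \<inter> cball 0 1)"
    proof
      fix z assume "z \<in> ?X ` cball 0 1"
      then obtain x where x: "norm x \<le> 1" "z = ?X x" by auto
      have "norm (P x) \<le> 1" using symmetric_idempotent_norm_le[OF Padj PP, of x] x(1) by simp
      moreover have "(P x, z) \<in> ?R" unfolding mem_R using x(2) PP by simp
      ultimately show "z \<in> ?R `` (?M \<inter> cball 0 1)" by (intro ImageI[of "P x"]) auto
    qed
  qed
  ultimately have cpt: "compact_operator ?M ?R \<longleftrightarrow> compact (closure (?X ` cball 0 1))"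
    by (simp add: compact_operator_def)
  have adj: "op_adjoint ?M ?R = ?R"
  proof -
    have "(f, g) \<in> op_adjoint ?M ?R \<longleftrightarrow> (f, g) \<in> ?R" for f g
    proof -
      have "(f, g) \<in> op_adjoint ?M ?R \<longleftrightarrow>
          f \<in> ?M \<and> g \<in> ?M \<and> (\<forall>u. cinner f (?X (P u)) = cinner g (P u))"
      proof -
        have "(\<forall>(u, v)\<in>?R. cinner f v = cinner g u) \<longleftrightarrow> (\<forall>u. cinner f (P (A (P u))) = cinner g (P u))"
          by blast
        thus ?thesis unfolding op_adjoint_def by (simp add: PP)
      qed
      also have "\<dots> \<longleftrightarrow> f \<in> ?M \<and> g \<in> ?M \<and> (\<forall>u. cinner (P (?X f)) u = cinner (P g) u)"
        using Xadj Padj unfolding adjoint_pair_def by metis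
      also have "\<dots> \<longleftrightarrow> f \<in> ?M \<and> g \<in> ?M \<and> P (?X f) = P g" using cinner_ext_left by metis
      also have "\<dots> \<longleftrightarrow> f \<in> ?M \<and> g = ?X f"
        using Pfix[of g] PP[of "A (P f)"] by (metis comp_apply rangeI)
      finally show ?thesis unfolding mem_R .
    qed
    thus ?thesis by auto
  qed
  have ker: "op_ker (op_shift (?R \<circ>\<^sub>o ?R) (- of_real (\<sigma>\<^sup>2))) = {x. ?X (?X x) = \<sigma>\<^sup>2 *\<^sub>R x}"
    if "\<sigma> > 0" for \<sigma>
  proof -
    have "(x, y) \<in> ?R \<circ>\<^sub>o ?R \<longleftrightarrow> x \<in> ?M \<and> y = ?X (?X x)" for x y
    proof -
      have "?X x \<in> ?M" by simp
      moreover have comp: "(x, y) \<in> U \<circ>\<^sub>o U \<longleftrightarrow> (\<exists>z. (x, z) \<in> U \<and> (z, y) \<in> U)" for U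
        by (auto simp: op_comp_def)
      ultimately show ?thesis unfolding comp[of ?R] mem_R by metis
    qed
    hence "op_ker (op_shift (?R \<circ>\<^sub>o ?R) (- of_real (\<sigma>\<^sup>2))) = {x. x \<in> ?M \<and> \<sigma>\<^sup>2 *\<^sub>R x = ?X (?X x)}"
      by (simp add: op_ker_def scaleR_eq_scaleC complex_vector.scale_minus_left)
    moreover have "x \<in> ?M" if "?X (?X x) = \<sigma>\<^sup>2 *\<^sub>R x" for x
    proof -
      have "x = (1 / \<sigma>\<^sup>2) *\<^sub>R ?X (?X x)" using that \<open>\<sigma> > 0\<close> by simp
      also have "\<dots> \<in> ?M" by (intro subspace_scaleR[OF M]) simp
      finally show ?thesis .
    qed
    ultimately show ?thesis by auto
  qed
  have "singular_values ?M ?R s \<longleftrightarrow> singular_values UNIV (op_of ?X) s" for s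
    unfolding singular_values_op_of[OF Xadj] unfolding singular_values_def adj
    by (simp only: ker cong: imp_cong)
  thus ?thesis
    unfolding schatten_class_op_of[OF Xlin] by (simp add: schatten_class_def cpt)
qed


section \<open>The reduced Krein-von Neumann operator\<close>

lemma orth_proj_exists:
  fixes M :: "'a::complex_hilbert set"
  assumes M: "complex_vector.subspace M" "closed M"
  obtains P where "projection_op P" "Id -\<^sub>o orth_proj M = op_of P" "range P = orth_compl M"
    "\<And>x. x - P x \<in> M"
proof -
  have ex: "\<exists>p. p \<in> orth_compl M \<and> x - p \<in> M" for x
  proof -
    obtain y where "y \<in> M" "x - y \<in> orth_compl M" using orthogonal_decomposition[OF M, of x] .
    thus ?thesis by (intro exI[of _ "x - y"]) simp
  qed
  then obtain P where P: "\<And>x. P x \<in> orth_compl M" "\<And>x. x - P x \<in> M" by metis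
  note C = subspace_orth_compl[of M]
  have uniq: "p = P x" if "p \<in> orth_compl M" "x - p \<in> M" for p x
  proof -
    have "p - P x \<in> orth_compl M" using C that(1) P(1) by (rule complex_vector.subspace_diff)
    moreover have "(x - P x) - (x - p) \<in> M" using M(1) P(2) that(2) by (rule complex_vector.subspace_diff)
    hence "p - P x \<in> M" by simp
    ultimately have "p - P x = 0" using orth_compl_Int by blast
    thus ?thesis by simp
  qed
  have add: "P (x + y) = P x + P y" for x y
  proof (rule uniq[symmetric])
    show "P x + P y \<in> orth_compl M" using C P(1) P(1) by (rule complex_vector.subspace_add)
    have "(x - P x) + (y - P y) \<in> M" using M(1) P(2) P(2) by (rule complex_vector.subspace_add)
    thus "x + y - (P x + P y) \<in> M" by (simp add: algebra_simps)
  qed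
  have scale: "P (c *\<^sub>C x) = c *\<^sub>C P x" for c x
  proof (rule uniq[symmetric])
    show "c *\<^sub>C P x \<in> orth_compl M" using C P(1) by (rule complex_vector.subspace_scale)
    have "c *\<^sub>C (x - P x) \<in> M" using M(1) P(2) by (rule complex_vector.subspace_scale)
    thus "c *\<^sub>C x - c *\<^sub>C P x \<in> M" by (simp add: complex_vector.scale_right_diff_distrib)
  qed
  have PP: "P (P x) = P x" for x
    using uniq[OF P(1), of "P x" x] complex_vector.subspace_0[OF M(1)] by simp
  have orth: "cinner (x - P x) (P y) = 0" "cinner (P x) (y - P y) = 0" for x y
    using P orth_compl_commute[of "P x" M "y - P y"] by (auto simp: orth_compl_def)
  have adj: "adjoint_pair P P"
    unfolding adjoint_pair_def
  proof (intro allI)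
    fix x y
    have "cinner (P x) y = cinner (P x) (P y)" using orth(2)[of x y] by (simp add: cinner_diff_right)
    also have "\<dots> = cinner x (P y)" using orth(1)[of x y] by (simp add: cinner_diff_left)
    finally show "cinner (P x) y = cinner x (P y)" .
  qed
  have "norm (P x) \<le> norm x" for x by (rule symmetric_idempotent_norm_le[OF adj PP])
  hence "bounded_linear P"
    by (intro bounded_linear_intro[where K = 1]) (simp_all add: add scaleR_eq_scaleC scale)
  hence proj: "projection_op P" using adj PP by (simp add: projection_op_def bounded_op_def scale)
  have gr: "(x, z) \<in> orth_proj M \<longleftrightarrow> z = x - P x" for x z
  proof
    assume "(x, z) \<in> orth_proj M"
    hence "x - z = P x" by (intro uniq) (simp_all add: orth_proj_def)
    thus "z = x - P x" by (metis add_diff_cancel_left' diff_add_cancel)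
  qed (simp add: orth_proj_def P)
  have "Id -\<^sub>o orth_proj M = op_of P"
  proof -
    have "(x, y) \<in> Id -\<^sub>o orth_proj M \<longleftrightarrow> y = P x" for x y
      unfolding op_diff_def by (simp add: gr)
    thus ?thesis by auto
  qed
  moreover have "range P = orth_compl M"
  proof
    show "orth_compl M \<subseteq> range P"
    proof
      fix x assume "x \<in> orth_compl M"
      hence "x = P x" using complex_vector.subspace_0[OF M(1)] by (intro uniq) simp_all
      thus "x \<in> range P" by (rule range_eqI)
    qed
  qed (use P(1) in auto)
  ultimately show thesis using that[OF proj] P(2) by blast
qed

theorem theorem4p3:
  fixes S SF SK Pker Q :: "'a::complex_hilbert operator"
    and Hhat :: "'a set" and \<epsilon> :: real and r :: enat and p :: ereal
  assumes "\<exists>D::'a set. countable D \<and> closure D = UNIV"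
    and "\<epsilon> > 0"
    and "linear_operator UNIV S"
    and "densely_defined S"
    and "closed S"
    and "bounded_below_by \<epsilon> S"
    and "r \<ge> 1"
    and "complex_dimension (op_ker (op_shift (op_adjoint UNIV S) (- \<i>))) = r"
    and "complex_dimension (op_ker (op_shift (op_adjoint UNIV S) \<i>)) = r"
    and "friedrichs_extension S SF"
    and "krein_von_neumann_extension S SK"
    and "p > 0"
  defines "Pker \<equiv> orth_proj (op_ker SK)"
    and "Q \<equiv> Id -\<^sub>o Pker"
    and "Hhat \<equiv> orth_compl (op_ker SK)"
  shows "((reduced_operator SK)\<inverse> \<in> schatten_class p Hhat
            \<longleftrightarrow> Q \<circ>\<^sub>o SF\<inverse> \<circ>\<^sub>o Q \<in> schatten_class p UNIV)
       \<and> (Q \<circ>\<^sub>o SF\<inverse> \<circ>\<^sub>o Q \<in> schatten_class p UNIV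
            \<longleftrightarrow> Q \<circ>\<^sub>o op_sqrt (SF\<inverse>) \<in> schatten_class (2 * p) UNIV)
       \<and> (Q \<circ>\<^sub>o op_sqrt (SF\<inverse>) \<in> schatten_class (2 * p) UNIV
            \<longleftrightarrow> op_sqrt (SF\<inverse>) \<circ>\<^sub>o Q \<in> schatten_class (2 * p) UNIV)
       \<and> (SF\<inverse> \<in> schatten_class p UNIV
            \<longrightarrow> (reduced_operator SK)\<inverse> \<in> schatten_class p Hhat)"
proof -
  note S = assms(3-6,2)
  note bb = friedrichs_extension_bounded_below[OF S assms(10)]
  have SF: "S \<subseteq> SF" "self_adjoint SF"
    using assms(10) by (simp_all add: friedrichs_extension_def nonneg_sa_extension_def)
  have "\<epsilon> / 2 > 0" using assms(2) by simp
  then obtain A where A: "positive_op A" "SF\<inverse> = op_of A"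
    by (rule self_adjoint_inverse[OF SF(2) bb])
  obtain C where C: "positive_op C" "\<And>x. C (C x) = A x" "op_sqrt (op_of A) = op_of C"
    by (rule op_sqrt_op_of[OF A(1)]) blast
  have "complex_vector.subspace (op_ker SK)" "closed (op_ker SK)"
    using krein_von_neumann_kernel[OF S assms(11)] subspace_orth_compl closed_orth_compl by simp_all
  from orth_proj_exists[OF this]
  obtain P where P: "projection_op P" "Q = op_of P" "range P = Hhat" "\<And>x. x - P x \<in> op_ker SK"
    unfolding Q_def Pker_def Hhat_def by blast
  have lin: "bounded_op P" "bounded_op C" and adj: "adjoint_pair P P" "adjoint_pair C C"
    using P(1) C(1) by (simp_all add: projection_op_def positive_op_def)
  have "P x \<in> orth_compl (op_ker SK)" for x using P(3) unfolding Hhat_def by blast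
  hence red: "(reduced_operator SK)\<inverse> = {(y, P (A y)) | y. y \<in> range P}"
    using reduced_operator_inverse[OF S assms(11) SF(1) A(2) _ P(4)] P(3) unfolding Hhat_def by simp
  have ii: "Q \<circ>\<^sub>o SF\<inverse> \<circ>\<^sub>o Q = op_of (P \<circ> A \<circ> P)" by (simp add: P(2) A(2) comp_assoc)
  have iii: "Q \<circ>\<^sub>o op_sqrt (SF\<inverse>) = op_of (P \<circ> C)" by (simp add: P(2) A(2) C(3))
  have iv: "op_sqrt (SF\<inverse>) \<circ>\<^sub>o Q = op_of (C \<circ> P)" by (simp add: P(2) A(2) C(3))
  have CP: "bounded_op (C \<circ> P)" "bounded_op (P \<circ> C)" "adjoint_pair (C \<circ> P) (P \<circ> C)"
    using lin adj by (simp_all add: bounded_op_compose adjoint_pair_compose)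
  (* T* T for T = C P, because C is self-adjoint with square A. *)
  have gram: "P \<circ> A \<circ> P = (P \<circ> C) \<circ> (C \<circ> P)" by (auto simp: C(2))
  have i_ii: "(reduced_operator SK)\<inverse> \<in> schatten_class p Hhat
      \<longleftrightarrow> op_of (P \<circ> A \<circ> P) \<in> schatten_class p UNIV"
    using schatten_class_restrict_iff[OF P(1) A(1), of p] red P(3) by simp
  have ii_iv: "op_of (P \<circ> A \<circ> P) \<in> schatten_class p UNIV
      \<longleftrightarrow> op_of (C \<circ> P) \<in> schatten_class (2 * p) UNIV"
    unfolding gram using schatten_class_gram_iff[OF CP assms(12)] .
  have iii_iv: "op_of (P \<circ> C) \<in> schatten_class q UNIV
      \<longleftrightarrow> op_of (C \<circ> P) \<in> schatten_class q UNIV" for q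
    using schatten_class_adjoint_imp[OF CP] schatten_class_adjoint_imp[OF CP(2,1) adjoint_pair_sym[OF CP(3)]]
    by blast
  have "SF\<inverse> \<in> schatten_class p UNIV \<longrightarrow> op_of (P \<circ> A \<circ> P) \<in> schatten_class p UNIV"
    using schatten_class_compression[OF P(1) A(1) _ assms(12)] unfolding A(2) by blast
  thus ?thesis unfolding ii iii iv using i_ii ii_iv iii_iv by blast
qed

end
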